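(* Let $G$ be a generic two-by-two game and let $(\nu,\mu)$ be a mixed-strategy Nash equilibrium of the associated quantum game $G^Q$ ($\nu$ is Player One's strategy and $\mu$ is Player Two's). Then $(\nu,\mu)$ is equivalent to a pair of mixed strategies, again denoted $(\nu,\mu)$, of one of the following types: (a) Each player plays each of four orthogonal unit quaternions with probability $1/4$. (b) Each player's strategy is supported on three of the four quaternions $1,i,j,k$. (c) $\mu$ is supported on two orthogonal points $1,u$; $\nu$ is supported on two orthogonal points $p,pv$ (with $u,v,p$ unit quaternions); and the quadruple $(p,pv,pu,pvu)$ is fully intertwined. (d) Each of $\mu$ and $\nu$ is supported on two orthogonal points, each played with probability $1/2$. Moreover, the supports of $\mu$ and $\nu$ lie in parallel planes. (e) Each player plays a pure strategy from the four-point set $\{1,i,j,k\}$.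
   Context: Quantum game. Let $G$ be a two-by-two game: two players, each with strategy set $\{C,D\}$, and payoff functions $P_1,P_2:\{C,D\}^2\to\mathbb{R}$. For a quaternion $p$ write $p=\pi_1(p)+\pi_2(p)i+\pi_3(p)j+\pi_4(p)k$ with $\pi_t(p)\in\mathbb{R}$. Unit quaternions are identified with $S^3\subset\mathbb{R}^4$; orthogonality is with respect to the standard inner product on $\mathbb{R}^4$. The associated quantum game $G^Q$ is the two-player game in which each player's strategy set is the set of unit quaternions and, if Player One plays $p$ and Player Two plays $q$, Player $i$ receives $$P_i^Q(p,q)=\pi_1(pq)^2P_i(C,C)+\pi_2(pq)^2P_i(D,D)+\pi_3(pq)^2P_i(C,D)+\pi_4(pq)^2P_i(D,C).$$ A mixed (quantum) strategy is a probability measure on the unit quaternions; a pure strategy is a measure supported on one point. For mixed strategies $\nu,\mu$, $P_i^Q(\nu,\mu)=\int P_i^Q(p,q)\,d\nu(p)\,d\mu(q)$. A mixed-strategy Nash equilibrium of $G^Q$ is a Nash equilibrium of the game in which strategies are mixed strategies with these payoffs. Genericity. Let $(X_1,Y_1),\ldots,(X_4,Y_4)$ be the four payoff pairs of $G$ ($X$ for Player One, $Y$ for Player Two). $G$ is generic if the $X_i$ are all distinct, the $Y_i$ are all distinct, the six sums $X_i+X_j$ ($i<j$) are all distinct and the six sums $Y_i+Y_j$ ($i<j$) are all distinct. Equivalence. Two mixed strategies $\mu,\mu'$ are equivalent if $\int\pi_t(pq)^2\,d\mu(q)=\int\pi_t(pq)^2\,d\mu'(q)$ for all unit quaternions $p$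 and all $t=1,2,3,4$. For a unit quaternion $u$ and mixed strategy $\nu$, the translates $\nu u$ and $u\nu$ are the measures $(\nu u)(A)=\nu(Au)$ and $(u\nu)(A)=\nu(uA)$, where $Au=\{xu: x\in A\}$, $uA=\{ux:x\in A\}$. Two pairs $(\nu,\mu)$ and $(\nu',\mu')$ are equivalent if there is a unit quaternion $u$ such that $\nu'$ is equivalent to $\nu u$ and $\mu'$ is equivalent to $u^{-1}\mu$. Intertwining. Let $K(A+Bi+Cj+Dk)=ABCD$ for real $A,B,C,D$. A quadruple $(p,q,r,s)$ of quaternions is intertwined if there is a nonzero constant $\alpha$ such that $\alpha K(Xp+Yq)=K(Xr+Ys)$ identically in the (real, commuting) polynomial variables $X,Y$. The intertwined quadruple $(p,q,r,s)$ is fully intertwined if $(p,r,q,s)$ is also intertwined. Parallel planes. The supports of $\mu$ and $\nu$ lie in parallel planes if the two-dimensional linear span of the support of $\nu$ equals $pW$ for some unit quaternion $p$, where $W$ is the two-dimensional linear span of the support of $\mu$. *)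

theory Defs
  imports "HOL-Probability.Probability"
begin

section \<open>Quaternions\<close>

text \<open>
  Quaternions are vectors in \<open>real^4\<close>, with the projection \<open>\<pi>\<^sub>t p\<close> written \<open>p $ t\<close>.  In this way
  orthogonality, spans, the norm and the Borel sets are the library's notions on Euclidean space.
  Pitfall: the library's \<open>*\<close>, \<open>1\<close> and \<open>inverse\<close> on \<open>real^4\<close> are not the quaternion ones (\<open>*\<close> and
  \<open>1\<close> are componentwise); only \<open>qmul\<close>, \<open>q1\<close>, \<open>qinv\<close> below are used as quaternion operations.
\<close>

type_synonym quaternion = "real^4"

definition quat :: "real \<Rightarrow> real \<Rightarrow> real \<Rightarrow> real \<Rightarrow> quaternion" where
  "quat a b c d = (\<chi> t. if t = 1 then a else if t = 2 then b else if t = 3 then c else d)"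

definition qmul :: "quaternion \<Rightarrow> quaternion \<Rightarrow> quaternion"  (infixl "\<odot>" 70) where
  "p \<odot> q = quat
     (p$1 * q$1 - p$2 * q$2 - p$3 * q$3 - p$4 * q$4)
     (p$1 * q$2 + p$2 * q$1 + p$3 * q$4 - p$4 * q$3)
     (p$1 * q$3 - p$2 * q$4 + p$3 * q$1 + p$4 * q$2)
     (p$1 * q$4 + p$2 * q$3 - p$3 * q$2 + p$4 * q$1)"

definition qconj :: "quaternion \<Rightarrow> quaternion" where
  "qconj p = quat (p$1) (- p$2) (- p$3) (- p$4)"

definition qinv :: "quaternion \<Rightarrow> quaternion" where
  "qinv p = (1 / (norm p)\<^sup>2) *\<^sub>R qconj p"

definition q1 :: quaternion where "q1 = quat 1 0 0 0"
definition qi :: quaternion where "qi = quat 0 1 0 0"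
definition qj :: quaternion where "qj = quat 0 0 1 0"
definition qk :: quaternion where "qk = quat 0 0 0 1"

abbreviation unit_quats :: "quaternion set" where
  "unit_quats \<equiv> sphere 0 1"

lemma quat_nth [simp]:
  "quat a b c d $ 1 = a" "quat a b c d $ 2 = b" "quat a b c d $ 3 = c" "quat a b c d $ 4 = d"
  by (simp_all add: quat_def)

lemma quat_eq_iff: "p = q \<longleftrightarrow> p$1 = q$1 \<and> p$2 = q$2 \<and> p$3 = q$3 \<and> p$4 = q$4"
  for p q :: quaternion
  by (simp add: vec_eq_iff forall_4)

lemma norm_quat_sq: "(norm p)\<^sup>2 = (p$1)\<^sup>2 + (p$2)\<^sup>2 + (p$3)\<^sup>2 + (p$4)\<^sup>2"
  for p :: quaternion
  unfolding power2_norm_eq_inner by (simp add: inner_vec_def sum_4 power2_eq_square)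

lemma qmul_assoc: "p \<odot> q \<odot> r = p \<odot> (q \<odot> r)"
  by (simp add: quat_eq_iff qmul_def algebra_simps)

lemma q1_qmul [simp]: "q1 \<odot> p = p" and qmul_q1 [simp]: "p \<odot> q1 = p"
  by (simp_all add: quat_eq_iff qmul_def q1_def)

lemma qi_qj_qk:
  "qi \<odot> qi = - q1" "qj \<odot> qj = - q1" "qk \<odot> qk = - q1"
  "qi \<odot> qj = qk" "qj \<odot> qk = qi" "qk \<odot> qi = qj"
  "qj \<odot> qi = - qk" "qk \<odot> qj = - qi" "qi \<odot> qk = - qj"
  by (simp_all add: quat_eq_iff qmul_def q1_def qi_def qj_def qk_def)

lemma norm_qmul: "norm (p \<odot> q) = norm p * norm q"
proof -
  have "(norm (p \<odot> q))\<^sup>2 = (norm p * norm q)\<^sup>2"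
    unfolding power_mult_distrib norm_quat_sq
    by (simp add: qmul_def power2_eq_square algebra_simps)
  then show ?thesis
    by (simp add: power2_eq_iff_nonneg)
qed

lemma norm_qinv: "norm p = 1 \<Longrightarrow> norm (qinv p) = 1"
proof -
  assume "norm p = 1"
  moreover have "(norm (qconj p))\<^sup>2 = (norm p)\<^sup>2"
    unfolding norm_quat_sq by (simp add: qconj_def)
  then have "norm (qconj p) = norm p"
    by (simp add: power2_eq_iff_nonneg)
  ultimately show ?thesis
    by (simp add: qinv_def)
qed

lemma qmul_qinv: "norm p = 1 \<Longrightarrow> p \<odot> qinv p = q1"
  and qinv_qmul: "norm p = 1 \<Longrightarrow> qinv p \<odot> p = q1"
proof -
  assume n: "norm p = 1"
  then have "(p$1)\<^sup>2 + (p$2)\<^sup>2 + (p$3)\<^sup>2 + (p$4)\<^sup>2 = 1"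
    using norm_quat_sq[of p] by simp
  then show "p \<odot> qinv p = q1" "qinv p \<odot> p = q1"
    using n by (simp_all add: quat_eq_iff qmul_def qinv_def qconj_def q1_def power2_eq_square)
qed

lemma continuous_on_qmul_left: "continuous_on A (\<lambda>x. u \<odot> x)"
  and continuous_on_qmul_right: "continuous_on A (\<lambda>x. x \<odot> u)"
proof -
  have cont: "continuous_on A (\<lambda>x. quat (f x) (g x) (h x) (k x))"
    if "continuous_on A f" "continuous_on A g" "continuous_on A h" "continuous_on A k"
    for f g h k :: "quaternion \<Rightarrow> real"
    unfolding quat_def
  proof (rule continuous_on_vec_lambda)
    show "continuous_on A (\<lambda>x. if t = 1 then f x else if t = 2 then g x else if t = 3 then h x else k x)"
      for t :: 4
      using that by (cases "t = 1"; cases "t = 2"; cases "t = 3") simp_all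
  qed
  show "continuous_on A (\<lambda>x. u \<odot> x)" "continuous_on A (\<lambda>x. x \<odot> u)"
    unfolding qmul_def by (intro cont continuous_intros)+
qed


section \<open>The quantum game\<close>

datatype move = C | D

definition quantum_payoff :: "(move \<Rightarrow> move \<Rightarrow> real) \<Rightarrow> quaternion \<Rightarrow> quaternion \<Rightarrow> real" where
  "quantum_payoff P p q =
     ((p \<odot> q) $ 1)\<^sup>2 * P C C + ((p \<odot> q) $ 2)\<^sup>2 * P D D
   + ((p \<odot> q) $ 3)\<^sup>2 * P C D + ((p \<odot> q) $ 4)\<^sup>2 * P D C"

definition unit_quat_borel :: "quaternion measure" where
  "unit_quat_borel = restrict_space borel unit_quats"

definition mixed_strategies :: "quaternion measure set" where
  "mixed_strategies = {\<mu>. prob_space \<mu> \<and> sets \<mu> = sets unit_quat_borel}"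

definition mixed_payoff ::
    "(move \<Rightarrow> move \<Rightarrow> real) \<Rightarrow> quaternion measure \<Rightarrow> quaternion measure \<Rightarrow> real" where
  "mixed_payoff P \<nu> \<mu> = (\<integral>q. (\<integral>p. quantum_payoff P p q \<partial>\<nu>) \<partial>\<mu>)"

definition quantum_nash ::
    "(move \<Rightarrow> move \<Rightarrow> real) \<Rightarrow> (move \<Rightarrow> move \<Rightarrow> real) \<Rightarrow>
     quaternion measure \<Rightarrow> quaternion measure \<Rightarrow> bool" where
  "quantum_nash P1 P2 \<nu> \<mu> \<longleftrightarrow>
     \<nu> \<in> mixed_strategies \<and> \<mu> \<in> mixed_strategies \<and>
     (\<forall>\<nu>' \<in> mixed_strategies. mixed_payoff P1 \<nu>' \<mu> \<le> mixed_payoff P1 \<nu> \<mu>) \<and>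
     (\<forall>\<mu>' \<in> mixed_strategies. mixed_payoff P2 \<nu> \<mu>' \<le> mixed_payoff P2 \<nu> \<mu>)"

text \<open>
  The four payoffs of a player are indexed by the four outcomes in \<open>move \<times> move\<close>, and the six
  sums \<open>X\<^sub>i + X\<^sub>j\<close> with \<open>i < j\<close> by the two-element sets of outcomes.
\<close>

definition generic_payoffs :: "(move \<Rightarrow> move \<Rightarrow> real) \<Rightarrow> bool" where
  "generic_payoffs P \<longleftrightarrow>
     inj (\<lambda>(a, b). P a b) \<and>
     inj_on (\<lambda>S. \<Sum>(a, b)\<in>S. P a b) {S. card S = 2}"

definition generic_game :: "(move \<Rightarrow> move \<Rightarrow> real) \<Rightarrow> (move \<Rightarrow> move \<Rightarrow> real) \<Rightarrow> bool" where
  "generic_game P1 P2 \<longleftrightarrow> generic_payoffs P1 \<and> generic_payoffs P2"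


section \<open>Equivalence of strategies\<close>

definition strategy_equiv :: "quaternion measure \<Rightarrow> quaternion measure \<Rightarrow> bool" where
  "strategy_equiv \<mu> \<mu>' \<longleftrightarrow>
     (\<forall>p \<in> unit_quats. \<forall>t. (\<integral>q. ((p \<odot> q) $ t)\<^sup>2 \<partial>\<mu>) = (\<integral>q. ((p \<odot> q) $ t)\<^sup>2 \<partial>\<mu>'))"

text \<open>
  The translates \<open>\<nu>u\<close> and \<open>u\<nu>\<close>, where \<open>(\<nu>u)(A) = \<nu>(Au)\<close> and \<open>(u\<nu>)(A) = \<nu>(uA)\<close>, are image measures
  under multiplication by the inverse of \<open>u\<close>; see the two lemmas below.
\<close>

definition right_translate :: "quaternion measure \<Rightarrow> quaternion \<Rightarrow> quaternion measure" where
  "right_translate \<nu> u = distr \<nu> unit_quat_borel (\<lambda>x. x \<odot> qinv u)"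

definition left_translate :: "quaternion \<Rightarrow> quaternion measure \<Rightarrow> quaternion measure" where
  "left_translate u \<nu> = distr \<nu> unit_quat_borel (\<lambda>x. qinv u \<odot> x)"

lemma space_unit_quat_borel: "space unit_quat_borel = unit_quats"
  by (simp add: unit_quat_borel_def space_restrict_space)

lemma measurable_unit_quat_borel:
  assumes "continuous_on UNIV f" and "\<And>x. norm x = 1 \<Longrightarrow> norm (f x) = 1"
  shows "f \<in> measurable unit_quat_borel unit_quat_borel"
  unfolding unit_quat_borel_def
proof (rule measurable_restrict_space3)
  show "f \<in> borel \<rightarrow>\<^sub>M borel"
    using assms(1) by (rule borel_measurable_continuous_onI)
  show "f \<in> unit_quats \<rightarrow> unit_quats"
    using assms(2) by simp
qed

lemma emeasure_right_translate:
  assumes "\<nu> \<in> mixed_strategies" and "u \<in> unit_quats" and "A \<in> sets unit_quat_borel"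
  shows "emeasure (right_translate \<nu> u) A = emeasure \<nu> ((\<lambda>x. x \<odot> u) ` A)"
proof -
  have s: "sets \<nu> = sets unit_quat_borel" and u: "norm u = 1" and A: "A \<subseteq> unit_quats"
    using assms sets.sets_into_space[OF assms(3)]
    by (auto simp: mixed_strategies_def space_unit_quat_borel)
  have m: "(\<lambda>x. x \<odot> qinv u) \<in> measurable \<nu> unit_quat_borel"
    unfolding measurable_cong_sets[OF s refl]
    using u by (intro measurable_unit_quat_borel continuous_on_qmul_right) (simp add: norm_qmul norm_qinv)
  have "(\<lambda>x. x \<odot> qinv u) -` A \<inter> space \<nu> = (\<lambda>x. x \<odot> u) ` A"
  proof (intro equalityI subsetI)
    fix x assume "x \<in> (\<lambda>x. x \<odot> qinv u) -` A \<inter> space \<nu>"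
    then show "x \<in> (\<lambda>x. x \<odot> u) ` A"
      using u by (intro image_eqI[of _ _ "x \<odot> qinv u"]) (auto simp: qmul_assoc qinv_qmul)
  next
    fix x assume "x \<in> (\<lambda>x. x \<odot> u) ` A"
    then show "x \<in> (\<lambda>x. x \<odot> qinv u) -` A \<inter> space \<nu>"
      using u A sets_eq_imp_space_eq[OF s]
      by (auto simp: qmul_assoc qmul_qinv space_unit_quat_borel norm_qmul)
  qed
  then show ?thesis
    unfolding right_translate_def using m assms(3) by (simp add: emeasure_distr)
qed

lemma emeasure_left_translate:
  assumes "\<nu> \<in> mixed_strategies" and "u \<in> unit_quats" and "A \<in> sets unit_quat_borel"
  shows "emeasure (left_translate u \<nu>) A = emeasure \<nu> ((\<lambda>x. u \<odot> x) ` A)"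
proof -
  have s: "sets \<nu> = sets unit_quat_borel" and u: "norm u = 1" and A: "A \<subseteq> unit_quats"
    using assms sets.sets_into_space[OF assms(3)]
    by (auto simp: mixed_strategies_def space_unit_quat_borel)
  have m: "(\<lambda>x. qinv u \<odot> x) \<in> measurable \<nu> unit_quat_borel"
    unfolding measurable_cong_sets[OF s refl]
    using u by (intro measurable_unit_quat_borel continuous_on_qmul_left) (simp add: norm_qmul norm_qinv)
  have "(\<lambda>x. qinv u \<odot> x) -` A \<inter> space \<nu> = (\<lambda>x. u \<odot> x) ` A"
  proof (intro equalityI subsetI)
    fix x assume "x \<in> (\<lambda>x. qinv u \<odot> x) -` A \<inter> space \<nu>"
    then show "x \<in> (\<lambda>x. u \<odot> x) ` A"
      using u by (intro image_eqI[of _ _ "qinv u \<odot> x"]) (auto simp: qmul_assoc[symmetric] qmul_qinv)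
  next
    fix x assume "x \<in> (\<lambda>x. u \<odot> x) ` A"
    then show "x \<in> (\<lambda>x. qinv u \<odot> x) -` A \<inter> space \<nu>"
      using u A sets_eq_imp_space_eq[OF s]
      by (auto simp: qmul_assoc[symmetric] qinv_qmul space_unit_quat_borel norm_qmul)
  qed
  then show ?thesis
    unfolding left_translate_def using m assms(3) by (simp add: emeasure_distr)
qed

definition pair_equiv ::
    "quaternion measure \<times> quaternion measure \<Rightarrow> quaternion measure \<times> quaternion measure \<Rightarrow> bool" where
  "pair_equiv = (\<lambda>(\<nu>, \<mu>) (\<nu>', \<mu>').
     \<exists>u \<in> unit_quats. strategy_equiv \<nu>' (right_translate \<nu> u) \<and>
                      strategy_equiv \<mu>' (left_translate (qinv u) \<mu>))"


section \<open>Supports, intertwining, parallel planes\<close>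

text \<open>
  The topological support.  Throughout, ``\<open>\<mu>\<close> is supported on the points \<open>x\<^sub>1, \<dots>, x\<^sub>n\<close>'' means that
  the support is exactly \<open>{x\<^sub>1, \<dots>, x\<^sub>n}\<close>: these points carry all the mass, and each has positive mass.
\<close>

definition msupport :: "quaternion measure \<Rightarrow> quaternion set" where
  "msupport \<mu> = {x \<in> space \<mu>. \<forall>U. open U \<and> x \<in> U \<longrightarrow> emeasure \<mu> (U \<inter> space \<mu>) > 0}"

definition qK :: "quaternion \<Rightarrow> real" where
  "qK p = p$1 * p$2 * p$3 * p$4"

definition intertwined ::
    "quaternion \<Rightarrow> quaternion \<Rightarrow> quaternion \<Rightarrow> quaternion \<Rightarrow> bool" where
  "intertwined p q r s \<longleftrightarrow>
     (\<exists>\<alpha>::real. \<alpha> \<noteq> 0 \<and>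
        (\<forall>X Y :: real. \<alpha> * qK (X *\<^sub>R p + Y *\<^sub>R q) = qK (X *\<^sub>R r + Y *\<^sub>R s)))"

definition fully_intertwined ::
    "quaternion \<Rightarrow> quaternion \<Rightarrow> quaternion \<Rightarrow> quaternion \<Rightarrow> bool" where
  "fully_intertwined p q r s \<longleftrightarrow> intertwined p q r s \<and> intertwined p r q s"

definition in_parallel_planes :: "quaternion measure \<Rightarrow> quaternion measure \<Rightarrow> bool" where
  "in_parallel_planes \<mu> \<nu> \<longleftrightarrow>
     dim (span (msupport \<mu>)) = 2 \<and> dim (span (msupport \<nu>)) = 2 \<and>
     (\<exists>p \<in> unit_quats. span (msupport \<nu>) = (\<lambda>w. p \<odot> w) ` span (msupport \<mu>))"

end

theory Submission
  imports Defs
begin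

text \<open>
  A mixed strategy matters only through its matrix of second moments, a density matrix on \<open>real^4\<close>;
  diagonalizing it replaces the strategy by an equivalent one supported on an orthonormal frame, with
  the eigenvalues as weights. Conjugating Player One's strategy makes the game symmetric, and a best
  response is then a top eigenvector of a matrix depending linearly on the opponent's moments. The
  cases are separated by the ranks of the two density matrices.

  If one of them has rank 3 or 4, a top eigenspace is at least three-dimensional. The map from moments
  to payoffs is a convolution over the Klein four-group, which is invertible for generic payoffs; so
  the opponent's moments are diagonal in a translate of \<open>1, i, j, k\<close>, either uniform or with distinct
  weights, and types (a) and (b) result. Rank 1 gives type (e).

  In the case of ranks 2 and 2, let \<open>\<mu>\<close> be supported on \<open>1, u\<close> and let \<open>\<alpha>\<close> be a best response of Player One. If
  the two weights of \<open>\<mu>\<close> differ, the eigenvector equation makes the vector of the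
  \<open>\<alpha>$t * (\<alpha> \<odot> u)$t\<close> orthogonal to \<open>1\<close>, \<open>X\<close> and \<open>X\<^sup>2\<close>, and the four linear forms in \<open>K\<close> pair up to give
  the intertwining identity. If they are equal, the top eigenspace is invariant under right
  multiplication by \<open>u\<close>, so that the planes of the two supports are parallel and the two intertwining
  identities become equivalent.
\<close>

section \<open>Diagonalization and orthonormal frames\<close>

text \<open>First variation: moving the maximizer \<open>v\<close> within \<open>S\<close> in a
  direction \<open>y\<close> orthogonal to it cannot raise the form to first order, so the cross
  term \<open>B v y\<close> vanishes. Here \<open>y\<close> is the part of \<open>z\<close>
  orthogonal to \<open>v\<close>.\<close>

lemma bilinear_sphere_maximum:
  fixes B :: "'a::real_inner \<Rightarrow> 'a \<Rightarrow> real"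
  assumes B: "bilinear B" and sym: "\<And>x y. B x y = B y x" and S: "subspace S"
    and v: "v \<in> S" "norm v = 1"
    and max: "\<And>x. x \<in> S \<Longrightarrow> norm x = 1 \<Longrightarrow> B x x \<le> B v v"
    and z: "z \<in> S"
  shows "B v z = B v v * inner v z"
proof -
  note bl = bilinear_ladd[OF B] bilinear_radd[OF B] bilinear_lmul[OF B] bilinear_rmul[OF B]
    bilinear_lsub[OF B] bilinear_rsub[OF B]
  have le: "B x x \<le> B v v * (norm x)\<^sup>2" if "x \<in> S" for x
  proof (cases "x = 0")
    case True
    then show ?thesis by (simp add: bilinear_lzero[OF B])
  next
    case False
    have "B ((1 / norm x) *\<^sub>R x) ((1 / norm x) *\<^sub>R x) \<le> B v v"
      using False that S by (intro max) (auto simp: subspace_scale)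
    then show ?thesis
      using False by (simp add: bl field_simps power2_eq_square)
  qed
  define y where "y = z - inner v z *\<^sub>R v"
  have vv: "inner v v = 1"
    using v(2) by (simp add: dot_square_norm)
  have vy: "inner v y = 0"
    by (simp add: y_def inner_diff_right vv)
  have yS: "y \<in> S"
    using S v z by (simp add: y_def subspace_diff subspace_scale)
  have quad: "2 * t * B v y \<le> t\<^sup>2 * (B v v * (norm y)\<^sup>2 - B y y)" for t
  proof -
    have "B (v + t *\<^sub>R y) (v + t *\<^sub>R y) \<le> B v v * (norm (v + t *\<^sub>R y))\<^sup>2"
      using S v yS by (intro le) (simp add: subspace_add subspace_scale)
    moreover have "(norm (v + t *\<^sub>R y))\<^sup>2 = 1 + t\<^sup>2 * (norm y)\<^sup>2"
      unfolding power2_norm_eq_inner using vy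
      by (simp add: inner_add_left inner_add_right inner_commute[of y v] vv power2_eq_square)
    ultimately show ?thesis
      by (simp add: bl sym[of y v] algebra_simps power2_eq_square)
  qed
  have "B v y = 0"
  proof (rule ccontr)
    assume n: "B v y \<noteq> 0"
    \<comment> \<open>\<open>M\<close> is a positive bound for the quadratic coefficient. For
      \<open>t = B v y / M\<close> the linear term exceeds the quadratic one unless
      \<open>B v y = 0\<close>.\<close>
    define M where "M = \<bar>B v v * (norm y)\<^sup>2 - B y y\<bar> + 1"
    have M: "M > 0" "B v v * (norm y)\<^sup>2 - B y y \<le> M"
      unfolding M_def by linarith+
    have "2 * (B v y / M) * B v y \<le> (B v y / M)\<^sup>2 * M"
      using quad[of "B v y / M"] mult_left_mono[OF M(2), of "(B v y / M)\<^sup>2"] by simp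
    then have "2 * (B v y)\<^sup>2 \<le> (B v y)\<^sup>2"
      using M by (simp add: field_simps power2_eq_square)
    with n show False
      by (simp add: power2_eq_square) (smt (verit) zero_less_mult_iff)
  qed
  then show ?thesis
    by (simp add: y_def bl)
qed

text \<open>The spectral theorem, by induction on the dimension: a maximizer \<open>v\<close> of the
  form on the unit sphere of \<open>S\<close> pairs to zero with every vector of \<open>S\<close>
  orthogonal to it, so the orthogonal complement of \<open>v\<close> in \<open>S\<close> can be
  diagonalized separately.\<close>

lemma bilinear_diagonalization:
  fixes B :: "'a::euclidean_space \<Rightarrow> 'a \<Rightarrow> real"
  assumes B: "bilinear B" and sym: "\<And>x y. B x y = B y x" and "subspace S"
  shows "\<exists>E\<subseteq>S. pairwise orthogonal E \<and> (\<forall>x\<in>E. norm x = 1) \<and> span E = S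
           \<and> (\<forall>x\<in>E. \<forall>y\<in>E. x \<noteq> y \<longrightarrow> B x y = 0)"
  using \<open>subspace S\<close>
proof (induction "dim S" arbitrary: S rule: less_induct)
  case less
  note S = \<open>subspace S\<close>
  show ?case
  proof (cases "S = {0}")
    case True
    then show ?thesis by (intro exI[of _ "{}"]) auto
  next
    case False
    then obtain x where x: "x \<in> S" "x \<noteq> 0"
      using S subspace_0 by blast
    have "(1 / norm x) *\<^sub>R x \<in> S \<inter> sphere 0 1"
      using x S by (simp add: subspace_scale)
    then have ne: "S \<inter> sphere 0 1 \<noteq> {}"
      by blast
    have "compact (S \<inter> sphere 0 1)"
      by (intro closed_Int_compact closed_subspace S compact_sphere)
    moreover have "continuous_on (S \<inter> sphere 0 1) (\<lambda>x. B x x)"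
      by (intro bilinear_continuous_on_compose[OF _ _ B] continuous_intros)
    ultimately obtain v where v: "v \<in> S" "norm v = 1"
      and "\<forall>y \<in> S \<inter> sphere 0 1. B y y \<le> B v v"
      using continuous_attains_sup[of "S \<inter> sphere 0 1" "\<lambda>x. B x x"] ne by auto
    then have max: "\<And>y. y \<in> S \<Longrightarrow> norm y = 1 \<Longrightarrow> B y y \<le> B v v"
      by simp
    have vv: "inner v v = 1"
      using v(2) by (simp add: dot_square_norm)
    define S' where "S' = {y \<in> S. inner v y = 0}"
    have S'eq: "S' = S \<inter> {y. orthogonal v y}"
      by (auto simp: S'_def orthogonal_def)
    have S': "subspace S'"
      unfolding S'eq by (intro subspace_inter S subspace_orthogonal_to_vector)
    have "v \<notin> S'"
      using vv by (simp add: S'_def)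
    then have "S' \<noteq> S"
      using v(1) by metis
    moreover have "S' \<subseteq> S"
      by (auto simp: S'_def)
    ultimately have "S' \<subset> S"
      by (rule psubsetI[rotated])
    then have "dim S' < dim S"
      using S S' by (metis dim_psubset span_eq_iff)
    from less.hyps[OF this S'] obtain E where E: "E \<subseteq> S'" "pairwise orthogonal E"
      "\<forall>x\<in>E. norm x = 1" "span E = S'" "\<forall>x\<in>E. \<forall>y\<in>E. x \<noteq> y \<longrightarrow> B x y = 0"
      by blast
    have Bv: "B v y = 0" "inner v y = 0" if "y \<in> E" for y
    proof -
      have y: "y \<in> S" "inner v y = 0"
        using that E(1) by (auto simp: S'_def)
      then show "B v y = 0" "inner v y = 0"
        using bilinear_sphere_maximum[OF B sym S v max y(1)] by auto
    qed
    have "S \<subseteq> span (insert v E)"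
    proof
      fix y assume y: "y \<in> S"
      have "y - inner v y *\<^sub>R v \<in> S'"
        using S v y vv by (simp add: S'_def subspace_diff subspace_scale inner_diff_right)
      then have "y - inner v y *\<^sub>R v \<in> span E"
        using E(4) by simp
      then show "y \<in> span (insert v E)"
        using span_breakdown_eq by blast
    qed
    moreover have "span (insert v E) \<subseteq> S"
      using E(1) v S by (intro span_minimal) (auto simp: S'_def)
    ultimately have 1: "span (insert v E) = S"
      by blast
    have 2: "pairwise orthogonal (insert v E)"
      using E(2) Bv(2) by (auto simp: pairwise_insert orthogonal_def inner_commute)
    have 3: "\<forall>x\<in>insert v E. \<forall>y\<in>insert v E. x \<noteq> y \<longrightarrow> B x y = 0"
      using E(5) Bv(1) sym by (metis insert_iff)
    have 4: "insert v E \<subseteq> S" "\<forall>x\<in>insert v E. norm x = 1"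
      using E v by (auto simp: S'_def)
    show ?thesis
      by (rule exI[where x = "insert v E"]) (intro conjI 1 2 3 4)
  qed
qed

definition orthoframe :: "(4 \<Rightarrow> quaternion) \<Rightarrow> bool" where
  "orthoframe b \<longleftrightarrow> (\<forall>i j. inner (b i) (b j) = (if i = j then 1 else 0))"

lemma orthoframe_inner: "orthoframe b \<Longrightarrow> inner (b i) (b j) = (if i = j then 1 else 0)"
  by (simp add: orthoframe_def)

lemma orthoframe_norm: "orthoframe b \<Longrightarrow> norm (b i) = 1"
  by (simp only: norm_eq_sqrt_inner orthoframe_inner if_True refl real_sqrt_one)

lemma orthoframe_inj: "orthoframe b \<Longrightarrow> inj b"
proof (rule injI, rule ccontr)
  fix i j assume "orthoframe b" "b i = b j" "i \<noteq> j"
  then show False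
    using orthoframe_inner[of b i j] orthoframe_inner[of b j j] by simp
qed

lemma orthoframe_expansion:
  assumes "orthoframe b"
  shows "x = (\<Sum>i\<in>UNIV. inner (b i) x *\<^sub>R b i)"
proof -
  note I = orthoframe_inner[OF assms]
  have inj: "inj b" by (rule orthoframe_inj[OF assms])
  have "independent (range b)"
    using I by (intro pairwise_orthogonal_independent)
      (auto simp: pairwise_def orthogonal_def, metis inner_zero_left zero_neq_one)
  moreover have "card (range b) = DIM(quaternion)"
    using inj by (simp add: card_image)
  ultimately have "span (range b) = UNIV"
    by (metis dim_UNIV dim_eq_full dim_span indep_card_eq_dim_span)
  define z where "z = x - (\<Sum>i\<in>UNIV. inner (b i) x *\<^sub>R b i)"
  have "inner z (b j) = 0" for j
    unfolding z_def inner_diff_left inner_sum_left inner_scaleR_left I inner_commute[of x "b j"]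
    by (simp add: if_distrib[of "\<lambda>c. _ * c"] cong: if_cong)
  then have "orthogonal z y" if "y \<in> range b" for y
    using that by (auto simp: orthogonal_def)
  then have "orthogonal z z"
    using orthogonal_to_span[of z "range b" z] \<open>span (range b) = UNIV\<close> by simp
  then show ?thesis
    by (simp add: orthogonal_def z_def)
qed

lemma orthoframe_parseval:
  assumes "orthoframe b"
  shows "(\<Sum>i\<in>UNIV. (inner (b i) x)\<^sup>2) = (norm x)\<^sup>2"
proof -
  have "inner x x = inner x (\<Sum>i\<in>UNIV. inner (b i) x *\<^sub>R b i)"
    using orthoframe_expansion[OF assms, of x] by simp
  then show ?thesis
    unfolding power2_norm_eq_inner
    by (simp add: inner_sum_right power2_eq_square inner_commute)
qed

lemma orthoframe_extension:
  assumes "pairwise orthogonal E" "\<And>x. x \<in> E \<Longrightarrow> norm x = 1" "span E = UNIV"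
  shows "\<exists>b. orthoframe b \<and> range b = E"
proof -
  have "0 \<notin> E"
    using assms(2) by force
  then have ind: "independent E"
    using assms(1) by (intro pairwise_orthogonal_independent)
  then have "card E = DIM(quaternion)"
    using assms(3) by (metis dim_UNIV dim_span indep_card_eq_dim_span)
  moreover have fin: "finite E"
    using ind by (rule independent_imp_finite)
  ultimately obtain b :: "4 \<Rightarrow> quaternion" where b: "bij_betw b UNIV E"
    using finite_same_card_bij[of "UNIV :: 4 set" E] by auto
  then have "range b = E"
    by (simp add: bij_betw_def)
  moreover have "orthoframe b"
    unfolding orthoframe_def
  proof (intro allI)
    fix i j
    have "inj b" using b by (simp add: bij_betw_def)
    then show "inner (b i) (b j) = (if i = j then 1 else 0)"
      using assms(1,2) \<open>range b = E\<close>
      by (auto simp: pairwise_def orthogonal_def norm_eq_1 inj_eq)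
  qed
  ultimately show ?thesis by blast
qed


section \<open>Intertwining from vanishing moments\<close>

text \<open>Orthogonality to the powers 0, 1, 2 of the payoffs. When the four entries of
  \<open>X\<close> are distinct, this Vandermonde system leaves a line, spanned by a vector without
  zero entries; the next lemmas extract this.\<close>

definition moment_free :: "quaternion \<Rightarrow> (4 \<Rightarrow> real) \<Rightarrow> bool" where
  "moment_free X c \<longleftrightarrow>
     (\<Sum>t\<in>UNIV. c t) = 0 \<and> (\<Sum>t\<in>UNIV. X$t * c t) = 0 \<and> (\<Sum>t\<in>UNIV. (X$t)\<^sup>2 * c t) = 0"

lemma moment_free_quadratic:
  assumes "moment_free X c"
  shows "(\<Sum>t\<in>UNIV. c t * ((X$t - x) * (X$t - y))) = 0"
proof -
  have "(\<Sum>t\<in>UNIV. c t * ((X$t - x) * (X$t - y)))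
      = (\<Sum>t\<in>UNIV. (X$t)\<^sup>2 * c t) - (x + y) * (\<Sum>t\<in>UNIV. X$t * c t) + x * y * (\<Sum>t\<in>UNIV. c t)"
    by (simp add: sum_4 algebra_simps power2_eq_square)
  then show ?thesis
    using assms by (simp add: moment_free_def)
qed

lemma moment_free_scale:
  assumes "moment_free X c"
  shows "moment_free X (\<lambda>t. r * c t)"
proof -
  have "(\<Sum>t\<in>UNIV. f t * (r * c t)) = r * (\<Sum>t\<in>UNIV. f t * c t)" for f :: "4 \<Rightarrow> real"
    by (simp only: sum_distrib_left mult.left_commute)
  from this[of "\<lambda>_. 1"] this[of "($) X"] this[of "\<lambda>t. (X$t)\<^sup>2"] show ?thesis
    using assms by (simp add: moment_free_def)
qed

lemma moment_free_diff: "moment_free X c \<Longrightarrow> moment_free X d \<Longrightarrow> moment_free X (\<lambda>t. c t - d t)"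
  by (simp add: moment_free_def right_diff_distrib sum_subtractf)

lemma four_complement:
  fixes s r :: 4
  assumes "s \<noteq> r"
  shows "\<exists>t u. t \<noteq> r \<and> u \<noteq> r \<and> (\<forall>i. i \<noteq> r \<longrightarrow> i = s \<or> i = t \<or> i = u)"
proof -
  have "card (UNIV - {s, r} :: 4 set) = 2"
    using assms by (simp add: card_Diff_subset)
  then obtain t u where "UNIV - {s, r} = {t, u}"
    by (meson card_2_iff)
  then have "i \<in> {t, u} \<longleftrightarrow> i \<noteq> s \<and> i \<noteq> r" for i
    by (metis Diff_iff UNIV_I insert_iff singletonD)
  then show ?thesis
    by (metis insert_iff singletonD)
qed

text \<open>The quadratic polynomial vanishing at \<open>X$t\<close> and \<open>X$u\<close> is
  tested against \<open>c\<close>. With \<open>c s = 0\<close> only the term at \<open>r\<close>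
  survives, and its polynomial factor is nonzero because the entries of \<open>X\<close> are
  distinct.\<close>

lemma moment_free_eq_zero:
  assumes inj: "inj (($) X)" and c: "moment_free X c" and s: "c s = 0"
  shows "c r = 0"
proof (cases "s = r")
  case False
  obtain t u where tu: "t \<noteq> r" "u \<noteq> r" "\<And>i. i \<noteq> r \<Longrightarrow> i = s \<or> i = t \<or> i = u"
    using four_complement[OF False] by blast
  have "(\<Sum>i\<in>UNIV. c i * ((X$i - X$t) * (X$i - X$u)))
      = (\<Sum>i\<in>{r}. c i * ((X$i - X$t) * (X$i - X$u)))"
    using tu(3) s by (intro sum.mono_neutral_right) auto
  then have "c r * ((X$r - X$t) * (X$r - X$u)) = 0"
    using moment_free_quadratic[OF c] by simp
  moreover have "X$r \<noteq> X$t" "X$r \<noteq> X$u"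
    using inj tu by (auto dest: injD)
  ultimately show ?thesis
    by simp
qed (use s in simp)

lemma moment_free_proportional:
  assumes inj: "inj (($) X)" and "moment_free X c" and d: "moment_free X d" "d s \<noteq> 0"
  shows "c t = c s / d s * d t"
proof -
  have "moment_free X (\<lambda>t. c t - c s / d s * d t)"
    by (intro moment_free_diff moment_free_scale assms)
  then have "c t - c s / d s * d t = 0"
    by (rule moment_free_eq_zero[OF inj, where s = s]) (simp add: d)
  then show ?thesis
    by simp
qed

text \<open>With only one negative entry, \<open>X$s\<close> would be a mean of the other three values whose square is
  the mean of their squares.\<close>

lemma moment_free_nonneg:
  assumes inj: "inj (($) X)" and c: "moment_free X c" and pos: "\<And>t. t \<noteq> s \<Longrightarrow> 0 \<le> c t"
  shows "c r = 0"
proof -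
  have "(\<Sum>i\<in>UNIV. c i * ((X$i - X$s) * (X$i - X$s))) = 0"
    by (rule moment_free_quadratic[OF c])
  moreover have "0 \<le> c i * ((X$i - X$s) * (X$i - X$s))" for i
    using pos[of i] by (cases "i = s") simp_all
  ultimately have *: "c i * ((X$i - X$s) * (X$i - X$s)) = 0" for i
    by (simp add: sum_nonneg_eq_0_iff)
  obtain i :: 4 where i: "i \<noteq> s"
    using four_complement[of 1 2] by (metis zero_neq_one)
  moreover have "X$i \<noteq> X$s"
    using inj i by (auto dest: injD)
  ultimately have "c i = 0"
    using *[of i] by simp
  then show ?thesis
    by (rule moment_free_eq_zero[OF inj c])
qed

text \<open>Excludes a split of the coordinates into one and three in the intertwining argument.
  Both \<open>a\<close> and \<open>b'\<close> are plus or minus the same coordinate vector, so the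
  zero sum forces \<open>b = - \<delta> *\<^sub>R a'\<close> by the equality case of Cauchy-Schwarz.
  The entries off \<open>s\<close> then have a common sign, which \<open>moment_free_nonneg\<close>
  forbids.\<close>

lemma moment_free_isolated_coordinate:
  fixes a b a' b' :: quaternion
  assumes inj: "inj (($) X)"
    and d: "moment_free X (\<lambda>t. a$t * b'$t + b$t * a'$t)"
    and norm: "norm a = 1" "norm b = 1" "norm a' = 1" "norm b' = 1"
    and s: "b$s = 0" "a'$s = 0" and t: "\<And>t. t \<noteq> s \<Longrightarrow> a$t = 0" "\<And>t. t \<noteq> s \<Longrightarrow> b'$t = 0"
  shows False
proof -
  define \<delta> where "\<delta> = a$s * b'$s"
  have a: "a = axis s (a$s)" and b': "b' = axis s (b'$s)"
    using t by (auto simp: vec_eq_iff axis_def)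
  have "inner a a = a$s * a$s" "inner b' b' = b'$s * b'$s"
    by (subst (1) a, simp add: inner_axis', subst (1) b', simp add: inner_axis')
  then have "(a$s)\<^sup>2 = 1" "(b'$s)\<^sup>2 = 1"
    using norm(1,4) by (simp_all add: power2_eq_square dot_square_norm)
  then have \<delta>: "\<delta>\<^sup>2 = 1" "\<delta> = 1 \<or> \<delta> = - 1"
    by (simp_all add: \<delta>_def power_mult_distrib flip: power2_eq_1_iff)
  have "inner a b' + inner b a' = 0"
    using d by (simp add: moment_free_def inner_vec_def sum.distrib)
  moreover have "inner a b' = \<delta>"
    by (subst a) (simp add: inner_axis' \<delta>_def)
  ultimately have ba: "inner b a' = - \<delta>"
    by simp
  have "inner (b + \<delta> *\<^sub>R a') (b + \<delta> *\<^sub>R a') = 1 + 2 * \<delta> * inner b a' + \<delta>\<^sup>2"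
    using norm(2,3)
    by (simp add: norm_eq_1 inner_add_left inner_add_right inner_commute[of a' b] power2_eq_square
        algebra_simps)
  then have "b + \<delta> *\<^sub>R a' = 0"
    using \<delta>(1) by (simp add: ba power2_eq_square)
  then have b: "b$t = - \<delta> * a'$t" for t
    by (simp add: vec_eq_iff add_eq_0_iff)
  have "0 \<le> - \<delta> * (a$t * b'$t + b$t * a'$t)" if "t \<noteq> s" for t
    using that t \<delta>(2) by (auto simp: b)
  then have "- \<delta> * (a$s * b'$s + b$s * a'$s) = 0"
    by (rule moment_free_nonneg[OF inj moment_free_scale[OF d]])
  then show False
    using s \<delta>(2) by (auto simp: \<delta>_def)
qed

text \<open>At each coordinate one of the two linear forms is zero. As \<open>a\<close> and
  \<open>a'\<close> are nonzero, each of the two pencils loses a coordinate, so both sides of the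
  identity are the zero polynomial and the constant 1 serves.\<close>

lemma intertwined_vanishing:
  assumes norm: "norm a = 1" "norm a' = 1"
    and z: "\<And>t x y. (x * a$t + y * b$t) * (x * a'$t + y * b'$t) = 0"
  shows "intertwined a b a' b'"
proof -
  have dich: "(a$t = 0 \<and> b$t = 0) \<or> (a'$t = 0 \<and> b'$t = 0)" for t
    using z[of 1 t 0] z[of 0 t 1] z[of 1 t 1] z[of 1 t "-1"] by auto
  have "\<exists>t. a$t \<noteq> 0"
    using norm(1) by (metis norm_zero vec_eq_iff zero_index zero_neq_one)
  then obtain t where "a'$t = 0 \<and> b'$t = 0"
    using dich by blast
  then have 1: "qK (x *\<^sub>R a' + y *\<^sub>R b') = 0" for x y
    using exhaust_4[of t] by (auto simp: qK_def)
  have "\<exists>t. a'$t \<noteq> 0"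
    using norm(2) by (metis norm_zero vec_eq_iff zero_index zero_neq_one)
  then obtain t where "a$t = 0 \<and> b$t = 0"
    using dich by blast
  then have 2: "qK (x *\<^sub>R a + y *\<^sub>R b) = 0" for x y
    using exhaust_4[of t] by (auto simp: qK_def)
  show ?thesis
    unfolding intertwined_def by (rule exI[of _ 1]) (simp add: 1 2)
qed

text \<open>If not all products \<open>(x * a$t + y * b$t) * (x * a'$t + y * b'$t)\<close> vanish, they are nonzero multiples of
  a single quadratic form. The normalization \<open>a$1 = 0\<close> and orthogonality force this form to be \<open>x * y\<close>
  up to scaling, so that at each \<open>t\<close> one of the two factors is a multiple of \<open>x\<close> and the other one of
  \<open>y\<close>; by the previous lemma each of the two arrangements occurs at exactly two \<open>t\<close>.\<close>

lemma intertwined_of_moment_free_normalized: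
  fixes a b a' b' :: quaternion
  assumes inj: "inj (($) X)"
    and mf: "\<And>x y. moment_free X (\<lambda>t. (x * a$t + y * b$t) * (x * a'$t + y * b'$t))"
    and norm: "norm a = 1" "norm b = 1" "norm a' = 1" "norm b' = 1"
    and ab: "inner a b = 0" and a1: "a$1 = 0"
  shows "intertwined a b a' b'"
proof -
  define d where "d = (\<lambda>t. a$t * b'$t + b$t * a'$t)"
  define e where "e = (\<lambda>t. b$t * b'$t)"
  have g: "moment_free X (\<lambda>t. a$t * a'$t)"
    using mf[of 1 0] by simp
  have e: "moment_free X e"
    using mf[of 0 1] by (simp add: e_def)
  \<comment> \<open>Polarization: \<open>d\<close> is the coefficient of \<open>x * y\<close>,
    obtained as the value at (1, 1) minus the values at (1, 0) and (0, 1).\<close>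
  have "moment_free X (\<lambda>t. (1 * a$t + 1 * b$t) * (1 * a'$t + 1 * b'$t) - a$t * a'$t - e t)"
    by (intro moment_free_diff mf g e)
  then have d: "moment_free X d"
    by (simp add: d_def e_def algebra_simps)
  have g0: "a$t * a'$t = 0" for t
    by (rule moment_free_eq_zero[OF inj g, of 1]) (simp add: a1)
  show ?thesis
  proof (cases "\<exists>t. d t \<noteq> 0")
    case False
    show ?thesis
    proof (cases "\<exists>t. e t \<noteq> 0")
      case False
      show ?thesis
      proof (rule intertwined_vanishing[OF norm(1,3)])
        fix t x y
        have "(x * a$t + y * b$t) * (x * a'$t + y * b'$t) = x\<^sup>2 * (a$t * a'$t) + x * y * d t + y\<^sup>2 * e t"
          by (simp add: d_def e_def algebra_simps power2_eq_square)
        then show "(x * a$t + y * b$t) * (x * a'$t + y * b'$t) = 0"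
          using g0 False \<open>\<not> (\<exists>t. d t \<noteq> 0)\<close> by simp
      qed
    next
      case True
      then have "e t \<noteq> 0" for t
        using moment_free_eq_zero[OF inj e] by blast
      then have "b$t \<noteq> 0" "b'$t \<noteq> 0" for t
        by (auto simp: e_def)
      moreover have "a$t * b'$t + b$t * a'$t = 0" for t
        using False by (simp add: d_def)
      ultimately have "a$t = 0" for t
        using g0[of t] by (metis add_cancel_left_right mult_eq_0_iff mult_zero_right)
      then have "a = 0"
        by (simp add: vec_eq_iff)
      then show ?thesis
        using norm by simp
    qed
  next
    case True
    then obtain s where s: "d s \<noteq> 0"
      by blast
    then have d0: "d t \<noteq> 0" for t
      using moment_free_eq_zero[OF inj d] by blast
    define \<rho> where "\<rho> = e s / d s"
    have ed: "e t = \<rho> * d t" for t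
      unfolding \<rho>_def by (rule moment_free_proportional[OF inj e d s])
    \<comment> \<open>Where \<open>a$t\<close> is nonzero, \<open>a'$t\<close> vanishes and
      \<open>e t = \<rho> * d t\<close> can be divided by \<open>b'$t\<close>. Summing over
      \<open>t\<close> gives \<open>inner a b = \<rho> * inner a a\<close>, hence
      \<open>\<rho> = 0\<close>.\<close>
    have "a$t * b$t = \<rho> * (a$t * a$t)" for t
    proof (cases "a$t = 0")
      case False
      then have "a'$t = 0"
        using g0[of t] by simp
      then show ?thesis
        using ed[of t] d0[of t] by (simp add: d_def e_def)
    qed simp
    then have "inner a b = \<rho> * inner a a"
      by (simp only: inner_vec_def inner_real_def sum_distrib_left)
    then have "\<rho> = 0"
      using ab norm(1) by (simp add: dot_square_norm)
    then have bb: "b$t * b'$t = 0" for t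
      using ed by (simp add: e_def)
    have dich: "(a$t \<noteq> 0 \<and> b'$t \<noteq> 0 \<and> b$t = 0 \<and> a'$t = 0) \<or>
                (a$t = 0 \<and> b'$t = 0 \<and> b$t \<noteq> 0 \<and> a'$t \<noteq> 0)" for t
      using g0[of t] bb[of t] d0[of t] by (auto simp: d_def)
    have bad1: False
      if "b$s = 0 \<and> a'$s = 0" "\<forall>t. t \<noteq> s \<longrightarrow> a$t = 0 \<and> b'$t = 0" for s
      using that by (intro moment_free_isolated_coordinate[OF inj d[unfolded d_def] norm]) auto
    have d': "moment_free X (\<lambda>t. b$t * a'$t + a$t * b'$t)"
      using d by (simp add: d_def add.commute)
    have bad2: False
      if "a$s = 0 \<and> b'$s = 0" "\<forall>t. t \<noteq> s \<longrightarrow> b$t = 0 \<and> a'$t = 0" for s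
      using that
      by (intro moment_free_isolated_coordinate[OF inj d' norm(2,1,4,3)]) auto
    have a0: "\<not> (\<forall>t. a$t = 0)"
      using norm(1) by (metis norm_zero vec_eq_iff zero_index zero_neq_one)
    \<comment> \<open>As \<open>a$1 = 0\<close>, the facts \<open>a0\<close>, \<open>bad1\<close>
      and \<open>bad2\<close> exclude that \<open>a\<close> has no, one or three nonzero
      coordinates. With two coordinates of each arrangement both sides are multiples of
      \<open>x^2 y^2\<close>, and \<open>\<alpha>\<close> is the quotient of the
      coefficients.\<close>
    define \<alpha> where "\<alpha> = (\<Prod>t\<in>UNIV. if a$t = 0 then a'$t / b$t else b'$t / a$t)"
    have "\<alpha> \<noteq> 0"
      using dich by (auto simp: \<alpha>_def)
    moreover have "\<alpha> * qK (x *\<^sub>R a + y *\<^sub>R b) = qK (x *\<^sub>R a' + y *\<^sub>R b')" for x y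
      using dich[of 1] dich[of 2] dich[of 3] dich[of 4] a1 bad1[of 2] bad1[of 3] bad1[of 4] bad2[of 1] a0
      unfolding forall_4 \<alpha>_def UNIV_4 qK_def
      by (elim disjE; simp)
    ultimately show ?thesis
      unfolding intertwined_def by blast
  qed
qed

text \<open>Hypotheses and conclusion are invariant under rotating the pairs \<open>a, b\<close> and
  \<open>a', b'\<close> by the same angle, and a suitable angle makes the first coordinate of the
  new \<open>a\<close> vanish.\<close>

lemma intertwined_of_moment_free:
  fixes a b a' b' :: quaternion
  assumes inj: "inj (($) X)"
    and mf: "\<And>x y. moment_free X (\<lambda>t. (x * a$t + y * b$t) * (x * a'$t + y * b'$t))"
    and norm: "norm a = 1" "norm b = 1" "norm a' = 1" "norm b' = 1"
    and ab: "inner a b = 0" "inner a' b' = 0"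
  shows "intertwined a b a' b'"
proof (cases "a$1 = 0")
  case True
  then show ?thesis
    using intertwined_of_moment_free_normalized[OF inj mf norm ab(1)] by blast
next
  case False
  define r where "r = sqrt ((a$1)\<^sup>2 + (b$1)\<^sup>2)"
  have r: "r \<noteq> 0" "r\<^sup>2 = (a$1)\<^sup>2 + (b$1)\<^sup>2"
    using False by (auto simp: r_def sum_power2_eq_zero_iff)
  \<comment> \<open>The unit vector with entries \<open>g\<close>, \<open>h\<close> is perpendicular
    to the one with entries \<open>a$1\<close>, \<open>b$1\<close>.\<close>
  define g where "g = b$1 / r"
  define h where "h = - a$1 / r"
  have gh: "g\<^sup>2 + h\<^sup>2 = 1"
    unfolding g_def h_def power_divide power2_minus add_divide_distrib[symmetric] add.commute[of "(b$1)\<^sup>2"]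
      r(2)[symmetric] using r(1) by simp
  have n: "norm (g *\<^sub>R p + h *\<^sub>R q) = 1" "norm (g *\<^sub>R q - h *\<^sub>R p) = 1"
    if "norm p = 1" "norm q = 1" "inner p q = 0" for p q :: quaternion
    using that gh
    by (simp_all add: norm_eq_sqrt_inner inner_add_left inner_add_right inner_diff_left inner_diff_right
        inner_commute[of q p] power2_eq_square add.commute)
  have "intertwined (g *\<^sub>R a + h *\<^sub>R b) (g *\<^sub>R b - h *\<^sub>R a) (g *\<^sub>R a' + h *\<^sub>R b') (g *\<^sub>R b' - h *\<^sub>R a')"
  proof (rule intertwined_of_moment_free_normalized[OF inj])
    fix x y
    show "moment_free X (\<lambda>t. (x * (g *\<^sub>R a + h *\<^sub>R b) $ t + y * (g *\<^sub>R b - h *\<^sub>R a) $ t) *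
                (x * (g *\<^sub>R a' + h *\<^sub>R b') $ t + y * (g *\<^sub>R b' - h *\<^sub>R a') $ t))"
      using mf[of "x * g - y * h" "x * h + y * g"] by (simp add: algebra_simps)
    show "inner (g *\<^sub>R a + h *\<^sub>R b) (g *\<^sub>R b - h *\<^sub>R a) = 0"
      using norm ab by (simp add: inner_add_left inner_diff_right inner_commute[of b a] dot_square_norm)
    show "(g *\<^sub>R a + h *\<^sub>R b) $ 1 = 0"
      by (simp add: g_def h_def)
  qed (use n norm ab in auto)
  then obtain \<alpha> where \<alpha>: "\<alpha> \<noteq> 0"
    "\<And>x y. \<alpha> * qK (x *\<^sub>R (g *\<^sub>R a + h *\<^sub>R b) + y *\<^sub>R (g *\<^sub>R b - h *\<^sub>R a))
         = qK (x *\<^sub>R (g *\<^sub>R a' + h *\<^sub>R b') + y *\<^sub>R (g *\<^sub>R b' - h *\<^sub>R a'))"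
    unfolding intertwined_def by blast
  \<comment> \<open>The inverse rotation, applied to the variables of the polynomial
    identity.\<close>
  have rot: "(x * g + y * h) *\<^sub>R (g *\<^sub>R p + h *\<^sub>R q) + (y * g - x * h) *\<^sub>R (g *\<^sub>R q - h *\<^sub>R p)
      = x *\<^sub>R p + y *\<^sub>R q" for x y and p q :: quaternion
  proof -
    have "(x * g + y * h) *\<^sub>R (g *\<^sub>R p + h *\<^sub>R q) + (y * g - x * h) *\<^sub>R (g *\<^sub>R q - h *\<^sub>R p)
      = (x * (g\<^sup>2 + h\<^sup>2)) *\<^sub>R p + (y * (g\<^sup>2 + h\<^sup>2)) *\<^sub>R q"
      by (simp add: vec_eq_iff algebra_simps power2_eq_square)
    then show ?thesis
      using gh by simp
  qed
  show ?thesis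
    unfolding intertwined_def using \<alpha>(1) \<alpha>(2)[of "x * g + y * h" "y * g - x * h" for x y]
    by (auto simp: rot)
qed


section \<open>Payoffs of orthonormal mixtures\<close>

lemma inner_quaternion:
  "inner x y = x$1 * y$1 + x$2 * y$2 + x$3 * y$3 + x$4 * y$4" for x y :: quaternion
  by (simp add: inner_vec_def sum_4)

lemma qconj_nth [simp]:
  "qconj x $ 1 = x$1" "qconj x $ 2 = - x$2" "qconj x $ 3 = - x$3" "qconj x $ 4 = - x$4"
  by (simp_all add: qconj_def)

lemma qmul_nth:
  "(p \<odot> q) $ 1 = p$1 * q$1 - p$2 * q$2 - p$3 * q$3 - p$4 * q$4"
  "(p \<odot> q) $ 2 = p$1 * q$2 + p$2 * q$1 + p$3 * q$4 - p$4 * q$3"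
  "(p \<odot> q) $ 3 = p$1 * q$3 - p$2 * q$4 + p$3 * q$1 + p$4 * q$2"
  "(p \<odot> q) $ 4 = p$1 * q$4 + p$2 * q$3 - p$3 * q$2 + p$4 * q$1"
  by (simp_all add: qmul_def)

lemma q_units_nth [simp]:
  "q1 $ 1 = 1" "q1 $ 2 = 0" "q1 $ 3 = 0" "q1 $ 4 = 0"
  "qi $ 1 = 0" "qi $ 2 = 1" "qi $ 3 = 0" "qi $ 4 = 0"
  "qj $ 1 = 0" "qj $ 2 = 0" "qj $ 3 = 1" "qj $ 4 = 0"
  "qk $ 1 = 0" "qk $ 2 = 0" "qk $ 3 = 0" "qk $ 4 = 1"
  by (simp_all add: q1_def qi_def qj_def qk_def)

definition qunit :: "4 \<Rightarrow> quaternion" where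
  "qunit t = axis t 1"

lemma qunit_simps [simp]: "qunit 1 = q1" "qunit 2 = qi" "qunit 3 = qj" "qunit 4 = qk"
  by (simp_all add: qunit_def quat_eq_iff axis_def)

lemma range_qunit: "range qunit = {q1, qi, qj, qk}"
  by (simp add: UNIV_4)

lemma bilinear_qmul: "bilinear (\<odot>)"
  by (auto simp: bilinear_def quat_eq_iff qmul_nth algebra_simps intro!: linearI)

lemmas qmul_bilinear_simps =
  bilinear_ladd[OF bilinear_qmul] bilinear_radd[OF bilinear_qmul]
  bilinear_lmul[OF bilinear_qmul] bilinear_rmul[OF bilinear_qmul]
  bilinear_lsub[OF bilinear_qmul] bilinear_rsub[OF bilinear_qmul]
  bilinear_lneg[OF bilinear_qmul] bilinear_rneg[OF bilinear_qmul]

lemma linear_qconj: "linear qconj"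
  by (auto simp: quat_eq_iff algebra_simps intro!: linearI)

lemma qconj_qconj [simp]: "qconj (qconj x) = x"
  by (simp add: quat_eq_iff)

lemma norm_qconj [simp]: "norm (qconj x) = norm x"
proof -
  have "(norm (qconj x))\<^sup>2 = (norm x)\<^sup>2"
    by (simp add: norm_quat_sq)
  then show ?thesis
    by (simp add: power2_eq_iff_nonneg)
qed

lemma qconj_qmul: "qconj (x \<odot> y) = qconj y \<odot> qconj x"
  by (simp add: quat_eq_iff qmul_nth algebra_simps)

lemma qconj_qmul_self: "qconj x \<odot> x = (norm x)\<^sup>2 *\<^sub>R q1" "x \<odot> qconj x = (norm x)\<^sup>2 *\<^sub>R q1"
  unfolding norm_quat_sq by (simp_all add: quat_eq_iff qmul_nth power2_eq_square algebra_simps)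

lemma inner_qmul_left: "inner (x \<odot> y) (x \<odot> z) = (norm x)\<^sup>2 * inner y z"
  unfolding norm_quat_sq by (simp add: inner_quaternion qmul_nth power2_eq_square algebra_simps)

lemma inner_qmul_right: "inner (y \<odot> x) (z \<odot> x) = (norm x)\<^sup>2 * inner y z"
  unfolding norm_quat_sq by (simp add: inner_quaternion qmul_nth power2_eq_square algebra_simps)

lemma inner_qconj: "inner (qconj x) (qconj y) = inner x y"
  by (simp add: inner_quaternion)

text \<open>Left multiplication by \<open>qconj x\<close> is adjoint to left multiplication by
  \<open>x\<close>; the amplitudes of the four outcomes are therefore the coordinates of
  \<open>y\<close> along \<open>x\<close>, \<open>x i\<close>, \<open>x j\<close>,
  \<open>x k\<close>.\<close>

lemma qconj_qmul_nth: "(qconj x \<odot> y) $ t = inner y (x \<odot> qunit t)"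
  using exhaust_4[of t] by (auto simp: inner_quaternion qmul_nth algebra_simps)

text \<open>Right multiplication by \<open>1\<close> is self-adjoint and by \<open>i\<close>,
  \<open>j\<close>, \<open>k\<close> skew-adjoint, so before squaring the two sides agree up to
  sign. The symmetry of \<open>wpay\<close> rests on this.\<close>

lemma inner_qunit_swap: "(inner y (x \<odot> qunit t))\<^sup>2 = (inner (y \<odot> qunit t) x)\<^sup>2"
proof -
  have "inner y (x \<odot> qunit t) = inner (y \<odot> qunit t) x \<or> inner y (x \<odot> qunit t) = - inner (y \<odot> qunit t) x"
    using exhaust_4[of t] by (auto simp: inner_quaternion qmul_nth algebra_simps)
  then show ?thesis
    by auto
qed

lemma orthoframe_qunit: "orthoframe qunit"
  by (simp add: orthoframe_def qunit_def inner_axis_axis)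

lemma orthoframe_qmul_left: "norm r = 1 \<Longrightarrow> orthoframe b \<Longrightarrow> orthoframe (\<lambda>t. r \<odot> b t)"
  by (simp add: orthoframe_def inner_qmul_left)

text \<open>The quadratic form of the density matrix with eigenvectors \<open>b j\<close> and
  eigenvalues \<open>w j\<close>. For a strategy with these second moments it is the mean of
  \<open>(inner z x)\<^sup>2\<close>.\<close>

definition mform :: "(4 \<Rightarrow> real) \<Rightarrow> (4 \<Rightarrow> quaternion) \<Rightarrow> quaternion \<Rightarrow> real" where
  "mform w b x = (\<Sum>j\<in>UNIV. w j * (inner (b j) x)\<^sup>2)"

definition mixture :: "(4 \<Rightarrow> real) \<Rightarrow> (4 \<Rightarrow> quaternion) \<Rightarrow> bool" where
  "mixture w b \<longleftrightarrow> orthoframe b \<and> (\<forall>j. 0 \<le> w j) \<and> (\<Sum>j\<in>UNIV. w j) = 1"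

text \<open>Player One's strategies are conjugated: the outcome is read off \<open>qconj x \<odot> y\<close> instead of
  \<open>x \<odot> y\<close>, which makes the payoff symmetric in the two players and turns the translations of the
  equivalence relation into a simultaneous left translation of both strategies.\<close>

definition wpay :: "quaternion \<Rightarrow> quaternion \<Rightarrow> quaternion \<Rightarrow> real" where
  "wpay X x y = (\<Sum>t\<in>UNIV. X$t * ((qconj x \<odot> y) $ t)\<^sup>2)"

text \<open>Polarization of the mean payoff against the mixture, which is recovered on the diagonal.
  The bilinear form allows best responses to be treated as eigenvectors.\<close>

definition bpay :: "quaternion \<Rightarrow> (4 \<Rightarrow> real) \<Rightarrow> (4 \<Rightarrow> quaternion) \<Rightarrow> quaternion \<Rightarrow> quaternion \<Rightarrow> real" where
  "bpay X w b x y = (\<Sum>j\<in>UNIV. w j * (\<Sum>t\<in>UNIV. X$t * ((qconj x \<odot> b j) $ t * (qconj y \<odot> b j) $ t)))"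

definition best :: "quaternion \<Rightarrow> (4 \<Rightarrow> real) \<Rightarrow> (4 \<Rightarrow> quaternion) \<Rightarrow> quaternion \<Rightarrow> bool" where
  "best X w b v \<longleftrightarrow> norm v = 1 \<and> (\<forall>x. norm x = 1 \<longrightarrow> bpay X w b x x \<le> bpay X w b v v)"

lemma wpay_commute: "wpay X x y = wpay X y x"
  unfolding wpay_def qconj_qmul_nth
  by (simp add: inner_qunit_swap[of y x] inner_commute[of x])

lemma bpay_wpay: "bpay X w b x x = (\<Sum>j\<in>UNIV. w j * wpay X x (b j))"
  by (simp add: bpay_def wpay_def power2_eq_square)

lemma bpay_commute: "bpay X w b x y = bpay X w b y x"
  by (simp add: bpay_def mult.commute)

lemma bilinear_bpay: "bilinear (bpay X w b)"
proof -
  have "linear (\<lambda>x. bpay X w b x y)" for y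
    by (rule linearI; unfold bpay_def qconj_qmul_nth qmul_bilinear_simps inner_add_right)
      (simp_all add: distrib_left distrib_right sum.distrib sum_distrib_left mult_ac)
  then show ?thesis
    unfolding bilinear_def by (simp add: bpay_commute[of X w b x for x])
qed

lemma bpay_mform: "bpay X w b x x =
  X$1 * mform w b x + X$2 * mform w b (x \<odot> qi) + X$3 * mform w b (x \<odot> qj) + X$4 * mform w b (x \<odot> qk)"
  unfolding bpay_wpay wpay_def qconj_qmul_nth sum_4 mform_def
  by (simp add: algebra_simps)

lemma best_bpay:
  assumes "best X w b v"
  shows "bpay X w b v z = bpay X w b v v * inner v z"
  using assms bilinear_sphere_maximum[OF bilinear_bpay bpay_commute subspace_UNIV, of v X w b z]
  by (auto simp: best_def)

lemma best_value: "best X w b v \<Longrightarrow> best X w b v' \<Longrightarrow> bpay X w b v v = bpay X w b v' v'"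
  unfolding best_def by (meson order_antisym)

lemma mform_minus [simp]: "mform w b (- x) = mform w b x"
  by (simp add: mform_def)

lemma sum_inner_qunit: "(\<Sum>t\<in>UNIV. (inner y (x \<odot> qunit t))\<^sup>2) = (norm x)\<^sup>2 * (norm y)\<^sup>2"
  unfolding norm_quat_sq by (simp add: sum_4 inner_quaternion qmul_nth power2_eq_square algebra_simps)

text \<open>A density matrix has trace one, and \<open>x\<close>, \<open>x i\<close>,
  \<open>x j\<close>, \<open>x k\<close> are orthogonal and of equal norm.\<close>

lemma mform_trace:
  assumes "mixture w b"
  shows "mform w b x + mform w b (x \<odot> qi) + mform w b (x \<odot> qj) + mform w b (x \<odot> qk) = (norm x)\<^sup>2"
proof -
  have n: "norm (b j) = 1" for j
    using assms by (simp add: mixture_def orthoframe_norm)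
  have "mform w b x + mform w b (x \<odot> qi) + mform w b (x \<odot> qj) + mform w b (x \<odot> qk)
     = (\<Sum>t\<in>UNIV. mform w b (x \<odot> qunit t))"
    by (simp add: sum_4)
  also have "\<dots> = (\<Sum>j\<in>UNIV. \<Sum>t\<in>UNIV. w j * (inner (b j) (x \<odot> qunit t))\<^sup>2)"
    unfolding mform_def by (rule sum.swap)
  also have "\<dots> = (\<Sum>j\<in>UNIV. w j * (norm x)\<^sup>2)"
    unfolding sum_distrib_left[symmetric] sum_inner_qunit n by simp
  also have "\<dots> = (norm x)\<^sup>2"
    using assms by (simp add: mixture_def flip: sum_distrib_right)
  finally show ?thesis .
qed

definition generic :: "quaternion \<Rightarrow> bool" where
  "generic X \<longleftrightarrow> inj (($) X) \<and> X$1 + X$2 \<noteq> X$3 + X$4 \<and> X$1 + X$3 \<noteq> X$2 + X$4 \<and> X$1 + X$4 \<noteq> X$2 + X$3"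

text \<open>\<open>bpay X w b x x\<close> is the convolution of \<open>X\<close> with the moments \<open>mform w b (x \<odot> qunit t)\<close> over
  the Klein four-group \<open>{\<plusminus>1, \<plusminus>i, \<plusminus>j, \<plusminus>k} / {\<plusminus>1}\<close>; genericity says that \<open>X\<close> has no vanishing Fourier
  coefficient at a nontrivial character.\<close>

lemma mform_inversion:
  assumes gen: "generic X" and mix: "mixture w b"
  defines "a \<equiv> \<lambda>x. bpay X w b x x"
  shows "4 * mform w b x = (norm x)\<^sup>2
    + (a x + a (x \<odot> qi) - a (x \<odot> qj) - a (x \<odot> qk)) / (X$1 + X$2 - X$3 - X$4)
    + (a x - a (x \<odot> qi) + a (x \<odot> qj) - a (x \<odot> qk)) / (X$1 + X$3 - X$2 - X$4)
    + (a x - a (x \<odot> qi) - a (x \<odot> qj) + a (x \<odot> qk)) / (X$1 + X$4 - X$2 - X$3)"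
proof -
  define m where "m = mform w b"
  define m1 where "m1 = m x"
  define m2 where "m2 = m (x \<odot> qi)"
  define m3 where "m3 = m (x \<odot> qj)"
  define m4 where "m4 = m (x \<odot> qk)"
  have 1: "X$1 + X$2 - X$3 - X$4 \<noteq> 0" "X$1 + X$3 - X$2 - X$4 \<noteq> 0" "X$1 + X$4 - X$2 - X$3 \<noteq> 0"
    using gen by (auto simp: generic_def)
  \<comment> \<open>Translating \<open>x\<close> by a unit permutes the moments, so each character
    sum of the payoffs factors into one of \<open>X\<close> and one of the moments.\<close>
  have a: "a x = X$1 * m1 + X$2 * m2 + X$3 * m3 + X$4 * m4"
    "a (x \<odot> qi) = X$1 * m2 + X$2 * m1 + X$3 * m4 + X$4 * m3"
    "a (x \<odot> qj) = X$1 * m3 + X$2 * m4 + X$3 * m1 + X$4 * m2"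
    "a (x \<odot> qk) = X$1 * m4 + X$2 * m3 + X$3 * m2 + X$4 * m1"
    by (simp_all add: a_def bpay_mform qmul_assoc qi_qj_qk qmul_bilinear_simps
        m1_def m2_def m3_def m4_def m_def)
  have "a x + a (x \<odot> qi) - a (x \<odot> qj) - a (x \<odot> qk) = (X$1 + X$2 - X$3 - X$4) * (m1 + m2 - m3 - m4)"
    "a x - a (x \<odot> qi) + a (x \<odot> qj) - a (x \<odot> qk) = (X$1 + X$3 - X$2 - X$4) * (m1 - m2 + m3 - m4)"
    "a x - a (x \<odot> qi) - a (x \<odot> qj) + a (x \<odot> qk) = (X$1 + X$4 - X$2 - X$3) * (m1 - m2 - m3 + m4)"
    unfolding a by algebra+
  moreover have "m1 + m2 + m3 + m4 = (norm x)\<^sup>2"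
    unfolding m1_def m2_def m3_def m4_def m_def by (rule mform_trace[OF mix])
  ultimately show ?thesis
    using 1 by (simp add: m1_def m_def)
qed

text \<open>The three best responses are eigenvectors for the same top eigenvalue
  \<open>\<Lambda>\<close>, so \<open>\<Lambda>\<close> times the inner product minus the payoff
  form annihilates them. A symmetric form with such a kernel is a multiple of the squared coordinate
  along \<open>r k\<close>.\<close>

lemma bpay_deficit:
  assumes r: "orthoframe r" and best: "\<And>i. i \<noteq> k \<Longrightarrow> best X w b (r i)"
  shows "\<exists>\<Lambda> \<kappa>. \<forall>x. bpay X w b x x = \<Lambda> * (norm x)\<^sup>2 - \<kappa> * (inner (r k) x)\<^sup>2"
proof -
  obtain i where i: "i \<noteq> k"
    using four_complement[of 1 2] by (metis zero_neq_one)
  define \<Lambda> where "\<Lambda> = bpay X w b (r i) (r i)"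
  define H where "H = (\<lambda>x y. \<Lambda> * inner x y - bpay X w b x y)"
  have H: "H (r j) y = 0" if "j \<noteq> k" for j y
    using best_bpay[OF best[OF that], of y] best_value[OF best[OF that] best[OF i]]
    by (simp add: H_def \<Lambda>_def)
  have lin: "linear (\<lambda>x. H x y)" for y
    using bilinear_bpay[of X w b]
    by (intro linearI) (simp_all add: H_def bilinear_ladd bilinear_lmul inner_add_left algebra_simps)
  have "H x y = inner (r k) x * H (r k) y" for x y
  proof -
    have "H x y = H (\<Sum>j\<in>UNIV. inner (r j) x *\<^sub>R r j) y"
      using orthoframe_expansion[OF r] by simp
    also have "\<dots> = (\<Sum>j\<in>UNIV. inner (r j) x * H (r j) y)"
      by (simp add: linear_sum[OF lin] linear_scale[OF lin])
    also have "\<dots> = (\<Sum>j\<in>{k}. inner (r j) x * H (r j) y)"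
      using H by (intro sum.mono_neutral_right) auto
    finally show ?thesis
      by simp
  qed
  note H1 = this
  have sym: "H x y = H y x" for x y
    by (simp add: H_def inner_commute bpay_commute)
  have "H x x = (inner (r k) x)\<^sup>2 * H (r k) (r k)" for x
    using H1[of x x] H1[of x "r k"] sym[of "r k" x] by (simp add: power2_eq_square)
  then have "bpay X w b x x = \<Lambda> * (norm x)\<^sup>2 - H (r k) (r k) * (inner (r k) x)\<^sup>2" for x
    by (metis H_def add_diff_cancel_left' diff_add_cancel mult.commute power2_norm_eq_inner)
  then show ?thesis
    by blast
qed

text \<open>Fourier inversion turns the deficit of the payoff form, of rank at most one, into
  moments that are diagonal in the frame \<open>r k \<odot> qunit t\<close>. The weights are
  distinct if \<open>\<kappa>\<close> is nonzero and uniform if it vanishes, as it does when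
  \<open>r k\<close> is also a best response.\<close>

lemma mform_of_three_best:
  assumes gen: "generic X" and mix: "mixture w b" and r: "orthoframe r"
    and best: "\<And>i. i \<noteq> k \<Longrightarrow> best X w b (r i)"
  shows "\<exists>\<beta>. (\<forall>x. mform w b x = mform \<beta> (\<lambda>t. r k \<odot> qunit t) x)
          \<and> (inj \<beta> \<or> (\<forall>t. \<beta> t = 1/4)) \<and> (best X w b (r k) \<longrightarrow> (\<forall>t. \<beta> t = 1/4))"
proof -
  from bpay_deficit[OF r best] obtain \<Lambda> \<kappa> where
    a: "\<And>x. bpay X w b x x = \<Lambda> * (norm x)\<^sup>2 - \<kappa> * (inner (r k) x)\<^sup>2"
    by blast
  define c1 where "c1 = 1 / (X$1 + X$2 - X$3 - X$4)"
  define c2 where "c2 = 1 / (X$1 + X$3 - X$2 - X$4)"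
  define c3 where "c3 = 1 / (X$1 + X$4 - X$2 - X$3)"
  have nz: "X$1 + X$2 - X$3 - X$4 \<noteq> 0" "X$1 + X$3 - X$2 - X$4 \<noteq> 0" "X$1 + X$4 - X$2 - X$3 \<noteq> 0"
    and X: "X$1 \<noteq> X$2" "X$1 \<noteq> X$3" "X$1 \<noteq> X$4" "X$2 \<noteq> X$3" "X$2 \<noteq> X$4" "X$3 \<noteq> X$4"
    using gen by (auto simp: generic_def inj_eq)
  \<comment> \<open>Up to sign and a factor 2, these sums and differences are the differences
    between entries of \<open>\<gamma>\<close>; each could vanish only if two payoffs were
    equal.\<close>
  have c: "c1 \<noteq> c2" "c1 \<noteq> c3" "c2 \<noteq> c3" "c1 + c2 \<noteq> 0" "c1 + c3 \<noteq> 0" "c2 + c3 \<noteq> 0"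
    using nz X unfolding c1_def c2_def c3_def by (simp_all add: divide_simps)
  define \<gamma> :: "4 \<Rightarrow> real" where
    "\<gamma> = (\<lambda>t. quat (c1 + c2 + c3) (c1 - c2 - c3) (c2 - c1 - c3) (c3 - c1 - c2) $ t)"
  define \<beta> where "\<beta> = (\<lambda>t. (1 - \<kappa> * \<gamma> t) / 4)"
  have nrk: "norm (r k) = 1"
    by (rule orthoframe_norm[OF r])
  have "mform w b x = mform \<beta> (\<lambda>t. r k \<odot> qunit t) x" for x
  proof -
    define s :: "4 \<Rightarrow> real" where "s = (\<lambda>t. (inner (r k \<odot> qunit t) x)\<^sup>2)"
    have s: "(inner (r k) (x \<odot> qunit t))\<^sup>2 = s t" for t
      unfolding s_def by (rule inner_qunit_swap)
    have ss: "s 1 + s 2 + s 3 + s 4 = (norm x)\<^sup>2"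
      using orthoframe_parseval[OF orthoframe_qmul_left[OF nrk orthoframe_qunit], of x]
      by (simp add: s_def sum_4)
    have n: "norm (x \<odot> qi) = norm x" "norm (x \<odot> qj) = norm x" "norm (x \<odot> qk) = norm x"
      using orthoframe_norm[OF orthoframe_qunit] by (metis norm_qmul mult.right_neutral qunit_simps)+
    have "4 * mform w b x = (norm x)\<^sup>2 + c1 * (\<kappa> * (s 3 + s 4 - s 1 - s 2))
        + c2 * (\<kappa> * (s 2 + s 4 - s 1 - s 3)) + c3 * (\<kappa> * (s 2 + s 3 - s 1 - s 4))"
      unfolding mform_inversion[OF gen mix, of x] a n c1_def c2_def c3_def
      using s[of 1] s[of 2] s[of 3] s[of 4]
      by (simp add: right_diff_distrib distrib_left add_divide_distrib diff_divide_distrib)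
    also have "\<dots> = (\<Sum>t\<in>UNIV. s t - \<kappa> * (\<gamma> t * s t))"
      unfolding ss[symmetric] by (simp add: sum_4 \<gamma>_def algebra_simps)
    also have "\<dots> = (\<Sum>t\<in>UNIV. 4 * (\<beta> t * s t))"
      by (simp add: \<beta>_def left_diff_distrib mult.assoc diff_divide_distrib)
    finally show ?thesis
      by (simp add: mform_def s_def flip: sum_distrib_left)
  qed
  moreover have "inj \<beta> \<or> (\<forall>t. \<beta> t = 1/4)"
  proof (cases "\<kappa> = 0")
    case False
    have "\<gamma> i \<noteq> \<gamma> j" if "i \<noteq> j" for i j
      using exhaust_4[of i] exhaust_4[of j] that c by (auto simp: \<gamma>_def)
    then have "inj \<beta>"
      using False by (auto simp: inj_def \<beta>_def)
    then show ?thesis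
      by simp
  qed (simp add: \<beta>_def)
  moreover have "\<forall>t. \<beta> t = 1/4" if "best X w b (r k)"
  proof -
    obtain i where i: "i \<noteq> k"
      using four_complement[of 1 2] by (metis zero_neq_one)
    have "bpay X w b (r i) (r i) = bpay X w b (r k) (r k)"
      by (rule best_value[OF best[OF i] that])
    then have "\<kappa> = 0"
      using i unfolding a by (simp add: orthoframe_norm[OF r] orthoframe_inner[OF r])
    then show ?thesis
      by (simp add: \<beta>_def)
  qed
  ultimately show ?thesis
    by blast
qed


section \<open>Ranks one, three and four\<close>

lemma mform_frame: "orthoframe b \<Longrightarrow> mform w b (b j) = w j"
  by (simp add: mform_def orthoframe_inner if_distrib[of "\<lambda>x. x\<^sup>2"] if_distrib[of "\<lambda>x. _ * x"] cong: if_cong)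

lemma mform_uniform:
  assumes "orthoframe b" "\<And>t. w t = 1/4"
  shows "mform w b x = (norm x)\<^sup>2 / 4"
proof -
  have "w = (\<lambda>t. 1/4)"
    using assms(2) by blast
  then have "mform w b x = 1/4 * (\<Sum>i\<in>UNIV. (inner (b i) x)\<^sup>2)"
    by (simp only: mform_def sum_distrib_left)
  then show ?thesis
    by (simp add: orthoframe_parseval[OF assms(1)])
qed

lemma mform_nonneg: "mixture w b \<Longrightarrow> 0 \<le> mform w b x"
  by (simp add: mform_def mixture_def sum_nonneg)

lemma mform_eq_zeroD:
  assumes "\<And>j. 0 \<le> w j" "mform w b x = 0"
  shows "w j = 0 \<or> inner (b j) x = 0"
proof -
  have "w j * (inner (b j) x)\<^sup>2 = 0"
    using assms unfolding mform_def by (subst (asm) sum_nonneg_eq_0_iff) auto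
  then show ?thesis
    by simp
qed

lemma orthoframe_collinear:
  assumes b: "orthoframe b" and "norm x = 1" and "\<And>j. j \<noteq> k \<Longrightarrow> inner (b j) x = 0"
  shows "\<exists>c. c\<^sup>2 = 1 \<and> x = c *\<^sub>R b k"
proof -
  have "x = (\<Sum>i\<in>UNIV. inner (b i) x *\<^sub>R b i)"
    by (rule orthoframe_expansion[OF b])
  also have "\<dots> = (\<Sum>i\<in>{k}. inner (b i) x *\<^sub>R b i)"
    using assms(3) by (intro sum.mono_neutral_right) auto
  finally have x: "x = inner (b k) x *\<^sub>R b k"
    by simp
  moreover have "\<bar>inner (b k) x\<bar> * norm (b k) = 1"
    using assms(2) x by (metis norm_scaleR)
  then have "(inner (b k) x)\<^sup>2 = 1"
    using orthoframe_norm[OF b, of k] by (metis mult.right_neutral one_power2 power2_abs)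
  ultimately show ?thesis
    by blast
qed

lemma mixture_of_mform_eq:
  assumes mix: "mixture w b" and r: "norm r = 1"
    and eq: "\<And>x. mform w b x = mform \<beta> (\<lambda>t. r \<odot> qunit t) x"
  shows "mixture \<beta> (\<lambda>t. r \<odot> qunit t)"
proof -
  have fr: "orthoframe (\<lambda>t. r \<odot> qunit t)"
    by (rule orthoframe_qmul_left[OF r orthoframe_qunit])
  have \<beta>: "\<beta> t = mform w b (r \<odot> qunit t)" for t
    unfolding eq by (rule mform_frame[OF fr, symmetric])
  then have "\<beta> 1 + \<beta> 2 + \<beta> 3 + \<beta> 4 = 1"
    using mform_trace[OF mix, of r] r by simp
  then show ?thesis
    using fr mform_nonneg[OF mix] by (simp add: mixture_def \<beta> sum_4)
qed

text \<open>The product of two of \<open>1\<close>, \<open>i\<close>, \<open>j\<close>,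
  \<open>k\<close> is again one of them up to sign, so moving the base point by
  \<open>qunit k\<close> permutes the frame up to signs, which the squares ignore.\<close>

lemma mform_translate:
  assumes c: "c\<^sup>2 = 1" and inj: "inj \<alpha>"
  shows "\<exists>\<alpha>'. inj \<alpha>' \<and> (\<forall>x. mform \<alpha> (\<lambda>t. (c *\<^sub>R (r \<odot> qunit k)) \<odot> qunit t) x = mform \<alpha>' (\<lambda>t. r \<odot> qunit t) x)"
proof -
  have c': "(c * y)\<^sup>2 = y\<^sup>2" for y
    using c by (simp add: power_mult_distrib)
  \<comment> \<open>Translation by \<open>k\<close> in the Klein four-group, in the indexing of
    \<open>qunit\<close>.\<close>
  define \<sigma> :: "4 \<Rightarrow> 4" where
    "\<sigma> = (\<lambda>t. if k = 1 then t
       else if k = 2 then (if t = 1 then 2 else if t = 2 then 1 else if t = 3 then 4 else 3)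
       else if k = 3 then (if t = 1 then 3 else if t = 2 then 4 else if t = 3 then 1 else 2)
       else (if t = 1 then 4 else if t = 2 then 3 else if t = 3 then 2 else 1))"
  have "\<sigma> (\<sigma> t) = t" for t
    using exhaust_4[of k] exhaust_4[of t] by (auto simp: \<sigma>_def)
  then have "inj \<sigma>"
    by (metis injI)
  then have "inj (\<alpha> \<circ> \<sigma>)"
    using inj by (rule inj_compose[rotated])
  moreover have "mform \<alpha> (\<lambda>t. (c *\<^sub>R (r \<odot> qunit k)) \<odot> qunit t) x = mform (\<alpha> \<circ> \<sigma>) (\<lambda>t. r \<odot> qunit t) x" for x
    using exhaust_4[of k]
    by (auto simp: mform_def sum_4 \<sigma>_def c' qmul_bilinear_simps qmul_assoc qi_qj_qk)
  ultimately show ?thesis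
    by blast
qed

section \<open>Equilibria in terms of density matrices\<close>

definition equilibrium where
  "equilibrium X Y s p t q \<longleftrightarrow> generic X \<and> generic Y \<and> mixture s p \<and> mixture t q
     \<and> (\<forall>i. s i > 0 \<longrightarrow> best X t q (p i)) \<and> (\<forall>j. t j > 0 \<longrightarrow> best Y s p (q j))"

lemma equilibrium_swap: "equilibrium X Y s p t q \<Longrightarrow> equilibrium Y X t q s p"
  by (auto simp: equilibrium_def)

text \<open>Four orthonormal best responses make the payoff form a multiple of the squared norm. The
  opponent's moments are then uniform, and all of the opponent's weights are positive as
  well.\<close>

lemma equilibrium_full_support:
  assumes eq: "equilibrium X Y s p t q" and s: "\<And>i. s i > 0"
  shows "mform t q x = (norm x)\<^sup>2 / 4" "t j > 0"
proof -
  have p: "orthoframe p" and q: "orthoframe q" and "generic X" "mixture t q"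
    and b: "best X t q (p i)" for i
    using eq s by (auto simp: equilibrium_def mixture_def)
  with mform_of_three_best[of X t q p 1] obtain \<beta> where
    \<beta>: "\<And>x. mform t q x = mform \<beta> (\<lambda>t. p 1 \<odot> qunit t) x" "\<And>t. \<beta> t = 1/4"
    by blast
  have m: "mform t q x = (norm x)\<^sup>2 / 4" for x
    unfolding \<beta>(1) using \<beta>(2)
    by (intro mform_uniform orthoframe_qmul_left orthoframe_qunit orthoframe_norm[OF p])
  then show "mform t q x = (norm x)\<^sup>2 / 4" .
  show "t j > 0"
    using m[of "q j"] by (simp add: mform_frame[OF q] orthoframe_norm[OF q])
qed

text \<open>The uniform alternative of \<open>mform_of_three_best\<close> would make every
  \<open>t j\<close> equal to \<open>1/4\<close>, whereas some weight is not positive.\<close>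

lemma equilibrium_three_support:
  assumes eq: "equilibrium X Y s p t q" and s: "\<And>i. i \<noteq> k \<Longrightarrow> s i > 0" and t: "\<not> (\<forall>j. t j > 0)"
  shows "\<exists>\<beta>. inj \<beta> \<and> (\<forall>x. mform t q x = mform \<beta> (\<lambda>t. p k \<odot> qunit t) x)"
proof -
  have p: "orthoframe p" and q: "orthoframe q" and "generic X" "mixture t q"
    and b: "i \<noteq> k \<Longrightarrow> best X t q (p i)" for i
    using eq s by (auto simp: equilibrium_def mixture_def)
  with mform_of_three_best[of X t q p k] obtain \<beta> where
    \<beta>: "\<And>x. mform t q x = mform \<beta> (\<lambda>t. p k \<odot> qunit t) x" "inj \<beta> \<or> (\<forall>t. \<beta> t = 1/4)"
    by blast
  have "\<not> (\<forall>t. \<beta> t = 1/4)"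
  proof
    assume "\<forall>t. \<beta> t = 1/4"
    then have "mform t q x = (norm x)\<^sup>2 / 4" for x
      unfolding \<beta>(1)
      by (intro mform_uniform orthoframe_qmul_left orthoframe_qunit orthoframe_norm[OF p]) blast
    from this[of "q j" for j] have "t j = 1/4" for j
      by (simp add: mform_frame[OF q] orthoframe_norm[OF q])
    then have "0 < t j" for j
      by (simp only: zero_less_divide_1_iff zero_less_numeral)
    with t show False
      by blast
  qed
  with \<beta> show ?thesis
    by blast
qed

lemma card_positive_of_inj:
  fixes \<beta> :: "4 \<Rightarrow> real"
  assumes "inj \<beta>" "\<And>t. 0 \<le> \<beta> t" "\<beta> k = 0"
  shows "card {t. \<beta> t > 0} = 3"
proof -
  have "{t. \<beta> t > 0} = UNIV - {k}"
    using assms by (auto simp: inj_def less_le)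
  then show ?thesis
    by (simp add: card_Diff_subset)
qed

text \<open>Injective weights vanish at no more than one index, so the null vectors of the form lie
  on a line spanned by a frame vector.\<close>

lemma mform_zero_collinear:
  assumes mix: "mixture \<beta> e" and inj: "inj \<beta>" and x: "mform \<beta> e x = 0" "norm x = 1"
  shows "\<exists>l c. \<beta> l = 0 \<and> c\<^sup>2 = 1 \<and> x = c *\<^sub>R e l"
proof -
  have e: "orthoframe e" and "\<And>t. 0 \<le> \<beta> t"
    using mix by (auto simp: mixture_def)
  note z = mform_eq_zeroD[OF this(2) x(1)]
  have "\<exists>l. inner (e l) x \<noteq> 0"
  proof (rule ccontr)
    assume "\<nexists>l. inner (e l) x \<noteq> 0"
    then show False
      using orthoframe_parseval[OF e, of x] x(2) by simp
  qed
  then obtain l where l: "inner (e l) x \<noteq> 0"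
    by blast
  then have "\<beta> l = 0"
    using z by blast
  moreover have "inner (e i) x = 0" if "i \<noteq> l" for i
    using z[of i] that inj \<open>\<beta> l = 0\<close> by (metis injD)
  ultimately show ?thesis
    using orthoframe_collinear[OF e x(2), of l] by blast
qed

text \<open>Both null vectors lie on the same line. Hence a mixture with these moments has at most
  one zero weight.\<close>

lemma mform_zeros_not_orthogonal:
  assumes mix: "mixture \<beta> e" and inj: "inj \<beta>"
    and x: "mform \<beta> e x = 0" "norm x = 1" and y: "mform \<beta> e y = 0" "norm y = 1"
  shows "inner x y \<noteq> 0"
proof -
  obtain l c l' c' where l: "\<beta> l = 0" "c\<^sup>2 = 1" "x = c *\<^sub>R e l"
    and l': "\<beta> l' = 0" "c'\<^sup>2 = 1" "y = c' *\<^sub>R e l'"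
    using mform_zero_collinear[OF mix inj x] mform_zero_collinear[OF mix inj y] by blast
  moreover have "l' = l"
    using l(1) l'(1) inj by (metis injD)
  ultimately have "inner x y = c * c'"
    using mix by (simp add: mixture_def orthoframe_inner)
  then show ?thesis
    using l(2) l'(2) by auto
qed

text \<open>The vector \<open>p k\<close> of weight zero provides the frame. A vector
  \<open>q j0\<close> of weight zero is a null vector of the opponent's form, hence a frame vector
  up to sign, and it is the only one. Exchanging the roles, Player One's moments become diagonal in
  the frame based at \<open>q j0\<close>, which is the same frame permuted up to sign.\<close>

lemma equilibrium_three:
  assumes eq: "equilibrium X Y s p t q" and card: "card {i. s i > 0} = 3" and t: "\<not> (\<forall>j. t j > 0)"
  shows "\<exists>r \<alpha> \<beta>. norm r = 1 \<and> mixture \<alpha> (\<lambda>t. r \<odot> qunit t) \<and> mixture \<beta> (\<lambda>t. r \<odot> qunit t)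
    \<and> card {k. \<alpha> k > 0} = 3 \<and> card {k. \<beta> k > 0} = 3
    \<and> (\<forall>x. mform s p x = mform \<alpha> (\<lambda>t. r \<odot> qunit t) x) \<and> (\<forall>x. mform t q x = mform \<beta> (\<lambda>t. r \<odot> qunit t) x)"
proof -
  have p: "orthoframe p" and q: "orthoframe q" and mix: "mixture s p" "mixture t q"
    and s0: "\<And>i. s i \<ge> 0" and t0: "\<And>i. t i \<ge> 0"
    using eq by (auto simp: equilibrium_def mixture_def)
  have "card (UNIV - {i. s i > 0}) = 1"
    using card by (simp add: card_Diff_subset)
  then obtain k where k: "UNIV - {i. s i > 0} = {k}"
    by (rule card_1_singletonE)
  then have sk: "s i > 0 \<longleftrightarrow> i \<noteq> k" for i
    by (metis Diff_iff UNIV_I mem_Collect_eq singleton_iff)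
  then have sk0: "s k = 0"
    using s0[of k] by (simp add: less_le) (metis sk less_le)
  define r where "r = p k"
  define e where "e = (\<lambda>t. r \<odot> qunit t)"
  have nr: "norm r = 1"
    unfolding r_def by (rule orthoframe_norm[OF p])
  have e: "orthoframe e"
    unfolding e_def by (rule orthoframe_qmul_left[OF nr orthoframe_qunit])
  obtain \<beta> where \<beta>: "inj \<beta>" "\<And>x. mform t q x = mform \<beta> e x"
    using equilibrium_three_support[OF eq _ t, of k] sk unfolding e_def r_def by blast
  have mix\<beta>: "mixture \<beta> e"
    unfolding e_def by (rule mixture_of_mform_eq[OF mix(2) nr]) (rule \<beta>(2)[unfolded e_def])
  then have \<beta>0: "\<And>t. 0 \<le> \<beta> t"
    by (simp add: mixture_def)
  have m0: "mform \<beta> e (q j) = 0" if "t j = 0" for j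
    using that \<beta>(2)[of "q j"] mform_frame[OF q] by simp
  obtain j0 where j0: "t j0 = 0"
    using t t0 by (metis less_le)
  obtain l c where l: "\<beta> l = 0" "c\<^sup>2 = 1" "q j0 = c *\<^sub>R e l"
    using mform_zero_collinear[OF mix\<beta> \<beta>(1) m0[OF j0] orthoframe_norm[OF q]] by blast
  have tj: "t j > 0" if "j \<noteq> j0" for j
  proof (rule ccontr)
    assume "\<not> t j > 0"
    then have "t j = 0"
      using t0[of j] by simp
    then have "inner (q j) (q j0) \<noteq> 0"
      by (intro mform_zeros_not_orthogonal[OF mix\<beta> \<beta>(1)] m0 j0 orthoframe_norm[OF q])
    then show False
      using that by (simp add: orthoframe_inner[OF q])
  qed
  have "\<not> (\<forall>i. s i > 0)"
    using sk0 by (metis less_irrefl)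
  from equilibrium_three_support[OF equilibrium_swap[OF eq] tj this]
  obtain \<alpha>0 where \<alpha>0: "inj \<alpha>0" "\<And>x. mform s p x = mform \<alpha>0 (\<lambda>t. q j0 \<odot> qunit t) x"
    by blast
  obtain \<alpha> where \<alpha>: "inj \<alpha>" "\<And>x. mform s p x = mform \<alpha> e x"
    using mform_translate[OF l(2) \<alpha>0(1), of r l] \<alpha>0(2) unfolding l(3) e_def by auto
  have mix\<alpha>: "mixture \<alpha> e"
    unfolding e_def by (rule mixture_of_mform_eq[OF mix(1) nr]) (rule \<alpha>(2)[unfolded e_def])
  then have \<alpha>0: "\<And>t. 0 \<le> \<alpha> t"
    by (simp add: mixture_def)
  \<comment> \<open>The first frame vector is \<open>r = p k\<close>, whose weight is zero.\<close>
  have "\<alpha> 1 = mform s p r"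
    using \<alpha>(2)[of "e 1"] mform_frame[OF e, of \<alpha> 1] by (simp add: e_def)
  then have "\<alpha> 1 = 0"
    using sk0 by (simp add: r_def mform_frame[OF p])
  then have "card {k. \<alpha> k > 0} = 3" "card {k. \<beta> k > 0} = 3"
    using card_positive_of_inj \<alpha>(1) \<alpha>0 \<beta>(1) \<beta>0 l(1) by blast+
  then show ?thesis
    using nr mix\<alpha> mix\<beta> \<alpha>(2) \<beta>(2) unfolding e_def by blast
qed

lemma mform_single:
  assumes "\<And>j. j \<noteq> k \<Longrightarrow> w j = 0" "w k = 1"
  shows "mform w b x = (inner (b k) x)\<^sup>2"
proof -
  have "mform w b x = (\<Sum>j\<in>{k}. w j * (inner (b j) x)\<^sup>2)"
    unfolding mform_def using assms(1) by (intro sum.mono_neutral_right) auto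
  then show ?thesis
    using assms(2) by simp
qed

lemma mixture_single:
  assumes "mixture w b" "{j. w j > 0} = {k}"
  shows "\<And>j. j \<noteq> k \<Longrightarrow> w j = 0" "w k = 1"
proof -
  show 0: "w j = 0" if "j \<noteq> k" for j
    using assms that unfolding mixture_def by (metis less_le mem_Collect_eq singletonD)
  have "(\<Sum>j\<in>UNIV. w j) = (\<Sum>j\<in>{k}. w j)"
    using 0 by (intro sum.mono_neutral_right) auto
  then show "w k = 1"
    using assms(1) by (simp add: mixture_def)
qed

text \<open>The payoff form is diagonal in the frame \<open>r \<odot> qunit t\<close>, with the
  distinct entries of \<open>Y\<close> as eigenvalues, so its top eigenspace is a line.\<close>

lemma best_response_to_pure:
  assumes Y: "inj (($) Y)" and r: "norm r = 1"
    and pay: "\<And>y. bpay Y s p y y = (\<Sum>t\<in>UNIV. Y$t * (inner (r \<odot> qunit t) y)\<^sup>2)"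
  shows "\<exists>k. \<forall>y. best Y s p y \<longrightarrow> (\<exists>c. c\<^sup>2 = 1 \<and> y = c *\<^sub>R (r \<odot> qunit k))"
proof -
  have e: "orthoframe (\<lambda>t. r \<odot> qunit t)"
    by (rule orthoframe_qmul_left[OF r orthoframe_qunit])
  have "Max (range (($) Y)) \<in> range (($) Y)"
    by (intro Max_in) auto
  then obtain k where "Max (range (($) Y)) = Y$k"
    by blast
  then have k: "Y$t \<le> Y$k" for t
    by (metis Max_ge finite finite_imageI rangeI)
  have "\<exists>c. c\<^sup>2 = 1 \<and> y = c *\<^sub>R (r \<odot> qunit k)" if y: "best Y s p y" for y
  proof (rule orthoframe_collinear[OF e])
    define z where "z = (\<lambda>t. (inner (r \<odot> qunit t) y)\<^sup>2)"
    show ny: "norm y = 1"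
      using y by (simp add: best_def)
    then have zs: "(\<Sum>t\<in>UNIV. z t) = 1"
      using orthoframe_parseval[OF e, of y] by (simp add: z_def)
    have "bpay Y s p (r \<odot> qunit k) (r \<odot> qunit k) = Y$k"
      unfolding pay by (simp add: orthoframe_inner[OF e] if_distrib[of "\<lambda>x. x\<^sup>2"]
          if_distrib[of "\<lambda>x. _ * x"] cong: if_cong)
    moreover have "bpay Y s p (r \<odot> qunit k) (r \<odot> qunit k) \<le> bpay Y s p y y"
      using y orthoframe_norm[OF e, of k] by (simp add: best_def)
    ultimately have "Y$k \<le> (\<Sum>t\<in>UNIV. Y$t * z t)"
      by (simp add: pay[of y] z_def)
    then have "(\<Sum>t\<in>UNIV. (Y$k - Y$t) * z t) \<le> 0"
      by (simp add: left_diff_distrib sum_subtractf zs flip: sum_distrib_left)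
    moreover have nn: "0 \<le> (Y$k - Y$t) * z t" for t
      using k[of t] by (simp add: z_def)
    ultimately have "(\<Sum>t\<in>UNIV. (Y$k - Y$t) * z t) = 0"
      by (meson order_antisym sum_nonneg)
    then have *: "(Y$k - Y$t) * z t = 0" for t
      using nn by (simp add: sum_nonneg_eq_0_iff)
    show "inner (r \<odot> qunit j) y = 0" if "j \<noteq> k" for j
      using *[of j] that Y by (auto simp: z_def dest: injD)
  qed
  then show ?thesis
    by blast
qed

text \<open>Best responses to a pure strategy lie on one line, so only one vector of the orthonormal
  frame \<open>q\<close> can carry weight.\<close>

lemma equilibrium_pure:
  assumes eq: "equilibrium X Y s p t q" and card: "card {i. s i > 0} = 1"
  shows "\<exists>r k. norm r = 1 \<and> (\<forall>x. mform s p x = (inner r x)\<^sup>2) \<and> (\<forall>x. mform t q x = (inner (r \<odot> qunit k) x)\<^sup>2)"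
proof -
  have p: "orthoframe p" and q: "orthoframe q" and mix: "mixture s p" "mixture t q"
    and Y: "inj (($) Y)" and best: "\<And>j. t j > 0 \<Longrightarrow> best Y s p (q j)"
    using eq by (auto simp: equilibrium_def mixture_def generic_def)
  obtain i where i: "{i. s i > 0} = {i}"
    using card by (rule card_1_singletonE)
  note si = mixture_single[OF mix(1) i]
  have "bpay Y s p y y = (\<Sum>t\<in>UNIV. Y$t * (inner (p i \<odot> qunit t) y)\<^sup>2)" for y
  proof -
    have "bpay Y s p y y = (\<Sum>j\<in>{i}. s j * wpay Y y (p j))"
      unfolding bpay_wpay using si(1) by (intro sum.mono_neutral_right) auto
    moreover have "wpay Y y (p i) = (\<Sum>t\<in>UNIV. Y$t * (inner (p i \<odot> qunit t) y)\<^sup>2)"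
      by (subst wpay_commute) (simp only: wpay_def qconj_qmul_nth inner_commute[of y])
    ultimately show ?thesis
      using si(2) by simp
  qed
  from best_response_to_pure[OF Y orthoframe_norm[OF p] this] obtain k where
    k: "\<And>y. best Y s p y \<Longrightarrow> \<exists>c. c\<^sup>2 = 1 \<and> y = c *\<^sub>R (p i \<odot> qunit k)"
    by blast
  have "\<exists>j. t j > 0"
  proof (rule ccontr)
    assume "\<nexists>j. t j > 0"
    then have "(\<Sum>j\<in>UNIV. t j) \<le> 0"
      by (intro sum_nonpos) (simp add: not_less)
    then show False
      using mix(2) by (simp add: mixture_def)
  qed
  then obtain j where j: "t j > 0"
    by blast
  obtain c where c: "c\<^sup>2 = 1" "q j = c *\<^sub>R (p i \<odot> qunit k)"
    using k[OF best[OF j]] by blast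
  have "j' = j" if j': "t j' > 0" for j'
  proof (rule ccontr)
    assume "j' \<noteq> j"
    then have 0: "inner (q j') (q j) = 0"
      by (simp add: orthoframe_inner[OF q])
    obtain c' where c': "c'\<^sup>2 = 1" "q j' = c' *\<^sub>R (p i \<odot> qunit k)"
      using k[OF best[OF j']] by blast
    have "norm (p i \<odot> qunit k) = 1"
      by (simp add: norm_qmul orthoframe_norm[OF p] orthoframe_norm[OF orthoframe_qunit])
    then have "inner (q j') (q j) = c' * c"
      by (simp add: c c' dot_square_norm)
    then show False
      using 0 c(1) c'(1) by auto
  qed
  then have "{j. t j > 0} = {j}"
    using j by blast
  note tj = mixture_single[OF mix(2) this]
  have "mform t q x = (inner (q j) x)\<^sup>2" for x
    by (rule mform_single; fact tj)
  then have "mform t q x = (inner (p i \<odot> qunit k) x)\<^sup>2" for x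
    using c by (simp add: power_mult_distrib)
  moreover have "mform s p x = (inner (p i) x)\<^sup>2" for x
    by (rule mform_single; fact si)
  ultimately show ?thesis
    using orthoframe_norm[OF p] by blast
qed

text \<open>Rank four passes to the opponent, and so do rank one and, when neither rank is four,
  rank three. In the remaining case both ranks are two.\<close>

lemma equilibrium_classification:
  assumes eq: "equilibrium X Y s p t q"
  shows "(\<forall>x. mform s p x = (norm x)\<^sup>2 / 4) \<and> (\<forall>x. mform t q x = (norm x)\<^sup>2 / 4)
    \<or> (\<exists>r \<alpha> \<beta>. norm r = 1 \<and> mixture \<alpha> (\<lambda>t. r \<odot> qunit t) \<and> mixture \<beta> (\<lambda>t. r \<odot> qunit t)
        \<and> card {k. \<alpha> k > 0} = 3 \<and> card {k. \<beta> k > 0} = 3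
        \<and> (\<forall>x. mform s p x = mform \<alpha> (\<lambda>t. r \<odot> qunit t) x) \<and> (\<forall>x. mform t q x = mform \<beta> (\<lambda>t. r \<odot> qunit t) x))
    \<or> (\<exists>r k l. norm r = 1 \<and> (\<forall>x. mform s p x = (inner (r \<odot> qunit k) x)\<^sup>2)
        \<and> (\<forall>x. mform t q x = (inner (r \<odot> qunit l) x)\<^sup>2))
    \<or> card {i. s i > 0} = 2 \<and> card {j. t j > 0} = 2"
    (is "?A \<or> ?B \<or> ?E \<or> ?CD")
proof -
  note eq' = equilibrium_swap[OF eq]
  have card: "card {i. w i > 0} = 1 \<or> card {i. w i > 0} = 2 \<or> card {i. w i > 0} = 3 \<or> (\<forall>i. w i > 0)"
    if "mixture w b" for w b
  proof -
    have "{i. w i > 0} \<noteq> {}"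
    proof
      assume "{i. w i > 0} = {}"
      then have "(\<Sum>j\<in>UNIV. w j) \<le> 0"
        by (intro sum_nonpos) (simp add: not_less)
      then show False
        using that by (simp add: mixture_def)
    qed
    then have "card {i. w i > 0} \<noteq> 0"
      by simp
    moreover have "card {i. w i > 0} \<le> 4"
      using card_mono[of UNIV "{i. w i > 0}"] by simp
    ultimately have "card {i. w i > 0} = 1 \<or> card {i. w i > 0} = 2 \<or> card {i. w i > 0} = 3
        \<or> card {i. w i > 0} = 4"
      by arith
    moreover have "\<forall>i. w i > 0" if "card {i. w i > 0} = 4"
      using that card_subset_eq[of UNIV "{i. w i > 0}"] by auto
    ultimately show ?thesis
      by blast
  qed
  have "mixture s p" "mixture t q"
    using eq by (auto simp: equilibrium_def)
  note cs = card[OF this(1)] and ct = card[OF this(2)]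
  consider (full) "(\<forall>i. s i > 0) \<or> (\<forall>j. t j > 0)"
    | (one) "card {i. s i > 0} = 1 \<or> card {j. t j > 0} = 1"
    | (three) "\<not> (\<forall>i. s i > 0)" "\<not> (\<forall>j. t j > 0)" "card {i. s i > 0} = 3 \<or> card {j. t j > 0} = 3"
    | (two) ?CD
    using cs ct by metis
  then show ?thesis
  proof cases
    case full
    then have st: "\<forall>i. s i > 0" "\<forall>j. t j > 0"
      using equilibrium_full_support(2)[OF eq] equilibrium_full_support(2)[OF eq'] by blast+
    then have ?A
      using equilibrium_full_support(1)[OF eq] equilibrium_full_support(1)[OF eq'] by blast
    then show ?thesis ..
  next
    case one
    then have ?E
    proof
      assume "card {i. s i > 0} = 1"
      from equilibrium_pure[OF eq this] show ?E
        by (metis qmul_q1 qunit_simps(1))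
    next
      assume "card {i. t i > 0} = 1"
      from equilibrium_pure[OF eq' this] show ?E
        by (metis qmul_q1 qunit_simps(1))
    qed
    then show ?thesis by blast
  next
    case three
    from three(3) have ?B
    proof
      assume "card {i. s i > 0} = 3"
      from equilibrium_three[OF eq this three(2)] show ?B .
    next
      assume "card {i. t i > 0} = 3"
      from equilibrium_three[OF eq' this three(1)] show ?B by metis
    qed
    then show ?thesis by blast
  next
    case two
    then show ?thesis by blast
  qed
qed


section \<open>Rank two\<close>

lemma imaginary_unit_square:
  assumes "norm u = 1" "u$1 = 0"
  shows "u \<odot> u = - q1"
  using assms norm_quat_sq[of u] by (simp add: quat_eq_iff qmul_nth power2_eq_square)

text \<open>Right multiplication by \<open>u\<close> is an isometry with square \<open>-1\<close>,
  hence skew-adjoint.\<close>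

lemma inner_imaginary_unit:
  assumes "norm u = 1" "u$1 = 0"
  shows "inner x (y \<odot> u) = - inner (x \<odot> u) y" "inner x (x \<odot> u) = 0"
proof -
  have *: "inner x (y \<odot> u) = - inner (x \<odot> u) y" for x y
  proof -
    have "inner x (y \<odot> u) = inner (x \<odot> u) (y \<odot> u \<odot> u)"
      by (simp add: inner_qmul_right assms(1))
    then show ?thesis
      by (simp only: qmul_assoc imaginary_unit_square[OF assms] qmul_bilinear_simps qmul_q1 inner_minus_right)
  qed
  then show "inner x (y \<odot> u) = - inner (x \<odot> u) y" .
  show "inner x (x \<odot> u) = 0"
    using *[of x x] by (simp add: inner_commute)
qed

definition xinner :: "quaternion \<Rightarrow> quaternion \<Rightarrow> quaternion \<Rightarrow> real" where
  "xinner X x y = (\<Sum>t\<in>UNIV. X$t * (x$t * y$t))"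

text \<open>The eigenvector equation is tested on \<open>\<alpha> \<odot> u\<close>, which gives the first moment, and on \<open>d \<odot> u\<close> with
  \<open>d$t = X$t * \<alpha>$t\<close>, which gives the second one.\<close>

lemma moment_free_of_eigenvector:
  assumes u: "norm u = 1" "u$1 = 0" and l: "l \<noteq> l'" "l' \<noteq> 0"
    and eig: "\<And>z. l * xinner X \<alpha> z + l' * xinner X (\<alpha> \<odot> u) (z \<odot> u) = \<Lambda> * inner \<alpha> z"
  shows "moment_free X (\<lambda>t. \<alpha>$t * (\<alpha> \<odot> u)$t)"
proof -
  note iu = inner_imaginary_unit[OF u]
  have uu: "x \<odot> u \<odot> u = - x" for x
    by (simp add: qmul_assoc imaginary_unit_square[OF u] qmul_bilinear_simps)
  define \<beta> where "\<beta> = \<alpha> \<odot> u"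
  define d :: quaternion where "d = (\<chi> t. X$t * \<alpha>$t)"
  have sym: "xinner X x y = xinner X y x" for x y
    by (simp add: xinner_def mult.commute)
  have neg: "xinner X x (- y) = - xinner X x y" for x y
    by (simp add: xinner_def sum_negf)
  have x\<alpha>: "xinner X \<alpha> y = inner d y" for y
    by (simp add: xinner_def d_def inner_vec_def mult.assoc)
  \<comment> \<open>Passing from \<open>\<alpha>\<close> to \<open>\<beta>\<close> exchanges the two
    terms up to a sign, which leaves the factor \<open>l - l'\<close>.\<close>
  have "(l - l') * xinner X \<alpha> \<beta> = 0"
    using eig[of \<beta>] unfolding \<beta>_def uu neg sym[of "\<alpha> \<odot> u"] iu(2) by (simp add: left_diff_distrib)
  then have 1: "xinner X \<alpha> \<beta> = 0"
    using l by simp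
  have "xinner X \<alpha> (d \<odot> u) = 0"
    by (simp only: x\<alpha> iu(2))
  moreover have "inner \<alpha> (d \<odot> u) = 0"
    unfolding iu(1)[of \<alpha> d] using 1 by (simp add: x\<alpha> \<beta>_def inner_commute)
  ultimately have "l' * xinner X \<beta> d = 0"
    using eig[of "d \<odot> u"] by (simp add: uu neg \<beta>_def)
  then have 2: "xinner X \<beta> d = 0"
    using l by simp
  have "xinner X \<beta> d = (\<Sum>t\<in>UNIV. (X$t)\<^sup>2 * (\<alpha>$t * \<beta>$t))"
    by (simp add: xinner_def d_def power2_eq_square mult_ac)
  moreover have "(\<Sum>t\<in>UNIV. \<alpha>$t * \<beta>$t) = 0"
    using iu(2)[of \<alpha>] by (simp add: \<beta>_def inner_vec_def)
  ultimately show ?thesis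
    using 1 2 by (simp add: moment_free_def \<beta>_def xinner_def)
qed

text \<open>A fourth vector completes the three best responses to a frame, and by
  \<open>mform_of_three_best\<close> the moments have distinct or uniform weights there. In neither
  case can the form vanish at the orthogonal vectors \<open>b k\<close> and
  \<open>b k'\<close>.\<close>

lemma no_three_best:
  assumes gen: "generic X" and mix: "mixture w b" and w: "k \<noteq> k'" "w k = 0" "w k' = 0"
    and best: "best X w b v1" "best X w b v2" "best X w b v3"
    and orth: "inner v1 v2 = 0" "inner v1 v3 = 0" "inner v2 v3 = 0"
  shows False
proof -
  have b: "orthoframe b"
    using mix by (simp add: mixture_def)
  have n: "norm v1 = 1" "norm v2 = 1" "norm v3 = 1"
    using best by (auto simp: best_def)
  have "dim {v1, v2, v3} \<le> card {v1, v2, v3}"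
    by (rule dim_le_card') simp
  also have "\<dots> \<le> 3"
    by (simp add: card_insert_if)
  finally have "dim {v1, v2, v3} < DIM(quaternion)"
    by simp
  then obtain y where y: "y \<noteq> 0" "\<And>x. x \<in> span {v1, v2, v3} \<Longrightarrow> orthogonal y x"
    using orthogonal_to_subspace_exists by blast
  then have y0: "inner y v1 = 0" "inner y v2 = 0" "inner y v3 = 0"
    by (simp_all add: orthogonal_def span_base)
  define v0 where "v0 = (1 / norm y) *\<^sub>R y"
  have v0: "norm v0 = 1" "inner v0 v1 = 0" "inner v0 v2 = 0" "inner v0 v3 = 0"
    using y(1) y0 by (simp_all add: v0_def)
  define r where "r = (\<lambda>t::4. if t = 1 then v0 else if t = 2 then v1 else if t = 3 then v2 else v3)"
  have r1: "norm (r 1) = 1"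
    using v0 by (simp add: r_def)
  have "inner (r i) (r j) = (if i = j then 1 else 0)" for i j
    using exhaust_4[of i] exhaust_4[of j] v0 n orth
    by (auto simp: r_def inner_commute dot_square_norm)
  then have r: "orthoframe r"
    by (simp add: orthoframe_def)
  have "best X w b (r i)" if "i \<noteq> 1" for i
    using exhaust_4[of i] that best by (auto simp: r_def)
  from mform_of_three_best[OF gen mix r this] obtain \<beta> where
    \<beta>: "\<And>x. mform w b x = mform \<beta> (\<lambda>t. r 1 \<odot> qunit t) x" "inj \<beta> \<or> (\<forall>t. \<beta> t = 1/4)"
    by blast
  have m0: "mform \<beta> (\<lambda>t. r 1 \<odot> qunit t) (b j) = 0" if "w j = 0" for j
    using that \<beta>(1)[of "b j"] mform_frame[OF b, of w j] by simp
  from \<beta>(2) show False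
  proof
    assume inj: "inj \<beta>"
    have "inner (b k) (b k') \<noteq> 0"
      by (rule mform_zeros_not_orthogonal[OF mixture_of_mform_eq[OF mix r1 \<beta>(1)] inj])
        (simp_all add: m0 w orthoframe_norm[OF b])
    then show False
      using w(1) by (simp add: orthoframe_inner[OF b])
  next
    assume "\<forall>t. \<beta> t = 1/4"
    then have "mform \<beta> (\<lambda>t. r 1 \<odot> qunit t) (b k) = (norm (b k))\<^sup>2 / 4"
      by (intro mform_uniform orthoframe_qmul_left orthoframe_qunit r1) blast
    then show False
      using m0[OF w(2)] by (simp add: orthoframe_norm[OF b])
  qed
qed

text \<open>The isometry taking \<open>y\<close> to \<open>qconj y \<odot> q j\<close> turns the
  payoff against \<open>q j\<close> into the diagonal form \<open>xinner X\<close>; the second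
  support point then enters through right multiplication by the imaginary unit
  \<open>u\<close>.\<close>

lemma two_support_eigenvector:
  assumes "mixture t q" and t: "{j. t j > 0} = {j, j'}" "j \<noteq> j'"
    and w: "\<And>z. bpay X t q w z = \<Lambda> * inner w z"
  defines "u \<equiv> qconj (q j) \<odot> q j'"
  shows "norm u = 1" "u$1 = 0" "x \<odot> q j \<odot> u = x \<odot> q j'"
    and "t j * xinner X (qconj w \<odot> q j) z + t j' * xinner X (qconj w \<odot> q j \<odot> u) (z \<odot> u)
       = \<Lambda> * inner (qconj w \<odot> q j) z"
proof -
  have q: "orthoframe q" and t0: "\<And>j. 0 \<le> t j"
    using assms(1) by (auto simp: mixture_def)
  note nq = orthoframe_norm[OF q]
  show "norm u = 1"
    by (simp add: u_def norm_qmul nq)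
  show "u$1 = 0"
    using orthoframe_inner[OF q, of j' j] t(2)
    by (simp add: u_def qconj_qmul_nth)
  have qq: "x \<odot> q j \<odot> u = x \<odot> q j'" for x
    by (simp add: u_def qmul_assoc qmul_assoc[of "q j", symmetric] qconj_qmul_self nq)
  then show "x \<odot> q j \<odot> u = x \<odot> q j'" .
  define y where "y = q j \<odot> qconj z"
  have y: "qconj y \<odot> q j = z"
    by (simp add: y_def qconj_qmul qmul_assoc qconj_qmul_self nq)
  have "qconj y \<odot> q j' = z \<odot> u"
    using qq[of "qconj y"] y by simp
  moreover have "bpay X t q w y = (\<Sum>i\<in>{j, j'}. t i * xinner X (qconj w \<odot> q i) (qconj y \<odot> q i))"
    unfolding bpay_def xinner_def
  proof (rule sum.mono_neutral_right)
    have "t i = 0" if "i \<notin> {j, j'}" for i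
      using that t(1) t0[of i] by (metis less_le mem_Collect_eq)
    then show "\<forall>i\<in>UNIV - {j, j'}. t i * (\<Sum>n\<in>UNIV. X$n * ((qconj w \<odot> q i)$n * (qconj y \<odot> q i)$n)) = 0"
      by auto
  qed auto
  moreover have "inner w y = inner (qconj w \<odot> q j) z"
    unfolding y[symmetric] by (simp add: inner_qmul_right nq inner_qconj)
  ultimately show "t j * xinner X (qconj w \<odot> q j) z + t j' * xinner X (qconj w \<odot> q j \<odot> u) (z \<odot> u)
       = \<Lambda> * inner (qconj w \<odot> q j) z"
    using w[of y] t(2) by (simp add: y qq)
qed

text \<open>Both \<open>p i\<close> and \<open>p i'\<close> belong to the top eigenvalue, so every
  combination of them satisfies the eigenvector equation. The moments thus vanish for all
  \<open>x\<close> and \<open>y\<close>, as the intertwining criterion requires.\<close>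

lemma equilibrium_two_unequal:
  assumes eq: "equilibrium X Y s p t q"
    and s: "{i. s i > 0} = {i, i'}" "i \<noteq> i'" and t: "{j. t j > 0} = {j, j'}" "j \<noteq> j'"
    and ne: "t j \<noteq> t j'"
  shows "intertwined (qconj (p i) \<odot> q j) (qconj (p i') \<odot> q j) (qconj (p i) \<odot> q j') (qconj (p i') \<odot> q j')"
proof -
  have p: "orthoframe p" and q: "orthoframe q" and X: "inj (($) X)" and mix: "mixture t q"
    and best: "best X t q (p i)" "best X t q (p i')"
    using eq s by (auto simp: equilibrium_def mixture_def generic_def)
  note np = orthoframe_norm[OF p] and nq = orthoframe_norm[OF q]
  define \<Lambda> where "\<Lambda> = bpay X t q (p i) (p i)"
  have eig: "bpay X t q (p i) z = \<Lambda> * inner (p i) z" "bpay X t q (p i') z = \<Lambda> * inner (p i') z" for z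
    using best_bpay[OF best(1), of z] best_bpay[OF best(2), of z] best_value[OF best]
    by (simp_all add: \<Lambda>_def)
  have tpos: "t j' \<noteq> 0"
    using t by (metis insertCI less_irrefl mem_Collect_eq)
  show ?thesis
  proof (rule intertwined_of_moment_free[OF X])
    fix x y
    define w where "w = x *\<^sub>R p i + y *\<^sub>R p i'"
    have w: "bpay X t q w z = \<Lambda> * inner w z" for z
      by (simp add: w_def bilinear_ladd[OF bilinear_bpay] bilinear_lmul[OF bilinear_bpay] eig
          inner_add_left algebra_simps)
    note ev = two_support_eigenvector[OF mix t w]
    have "moment_free X (\<lambda>k. (qconj w \<odot> q j)$k * (qconj w \<odot> q j \<odot> (qconj (q j) \<odot> q j'))$k)"
      by (rule moment_free_of_eigenvector[OF ev(1,2) ne tpos ev(4)])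
    then show "moment_free X (\<lambda>k. (x * (qconj (p i) \<odot> q j)$k + y * (qconj (p i') \<odot> q j)$k) *
        (x * (qconj (p i) \<odot> q j')$k + y * (qconj (p i') \<odot> q j')$k))"
      unfolding ev(3)
      by (simp add: w_def linear_add[OF linear_qconj] linear_scale[OF linear_qconj] qmul_bilinear_simps)
  qed (use s(2) in \<open>simp_all add: norm_qmul np nq inner_qmul_right inner_qconj orthoframe_inner[OF p]\<close>)
qed

text \<open>For equal weights the eigenvector equation is invariant under right multiplication by
  \<open>u = qconj (q j) \<odot> q j'\<close>; as there are no three orthonormal best responses, \<open>p i'\<close> is up to sign the
  image \<open>p2\<close> of \<open>p i\<close> under this symmetry.\<close>

lemma equilibrium_two_equal:
  assumes eq: "equilibrium X Y s p t q"
    and s: "{i. s i > 0} = {i, i'}" "i \<noteq> i'" and t: "{j. t j > 0} = {j, j'}" "j \<noteq> j'"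
    and tt: "t j = t j'"
  shows "\<exists>c. c\<^sup>2 = 1 \<and> qconj (p i') \<odot> q j = c *\<^sub>R (qconj (p i) \<odot> q j')
           \<and> qconj (p i') \<odot> q j' = - c *\<^sub>R (qconj (p i) \<odot> q j)"
proof -
  have p: "orthoframe p" and q: "orthoframe q" and gen: "generic X" and mix: "mixture t q"
    and best: "best X t q (p i)" "best X t q (p i')" and t0: "\<And>j. 0 \<le> t j"
    using eq s by (auto simp: equilibrium_def mixture_def)
  note np = orthoframe_norm[OF p] and nq = orthoframe_norm[OF q]
  define \<Lambda> where "\<Lambda> = bpay X t q (p i) (p i)"
  have eig: "bpay X t q (p i) z = \<Lambda> * inner (p i) z" "bpay X t q (p i') z = \<Lambda> * inner (p i') z" for z
    using best_bpay[OF best(1), of z] best_bpay[OF best(2), of z] best_value[OF best]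
    by (simp_all add: \<Lambda>_def)
  define u where "u = qconj (q j) \<odot> q j'"
  note ev = two_support_eigenvector[OF mix t eig(1), folded u_def]
  note iu = inner_imaginary_unit[OF ev(1,2)]
  have uu: "x \<odot> u \<odot> u = - x" for x
    by (simp add: qmul_assoc imaginary_unit_square[OF ev(1,2)] qmul_bilinear_simps)
  define a where "a = qconj (p i) \<odot> q j"
  have au: "qconj (p i) \<odot> q j' = a \<odot> u"
    unfolding a_def by (rule ev(3)[symmetric])
  \<comment> \<open>Chosen so that \<open>qconj p2 \<odot> q j\<close> is
    \<open>a \<odot> u\<close>.\<close>
  define p2 where "p2 = q j \<odot> qconj (a \<odot> u)"
  have p2: "qconj p2 \<odot> q j = a \<odot> u"
    by (simp add: p2_def qconj_qmul qmul_assoc qconj_qmul_self nq)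
  then have p2': "qconj p2 \<odot> q j' = - a"
    using ev(3)[of "qconj p2"] uu by simp
  have n2: "norm p2 = 1"
    by (simp add: p2_def norm_qmul nq a_def np ev(1))
  have xneg: "xinner X x (- y) = - xinner X x y" "xinner X (- x) y = - xinner X x y" for x y
    by (simp_all add: xinner_def sum_negf)
  have t_out: "t k = 0" if "k \<notin> {j, j'}" for k
    using that t(1) t0[of k] by (metis less_le mem_Collect_eq)
  have eig2: "bpay X t q p2 z = \<Lambda> * inner p2 z" for z
  proof -
    define z' where "z' = qconj z \<odot> q j"
    have "bpay X t q p2 z = (\<Sum>i\<in>{j, j'}. t i * xinner X (qconj p2 \<odot> q i) (qconj z \<odot> q i))"
      unfolding bpay_def xinner_def
      by (rule sum.mono_neutral_right) (use t_out in auto)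
    also have "\<dots> = t j * xinner X (a \<odot> u) z' - t j * xinner X a (z' \<odot> u)"
      using t(2) tt ev(3)[of "qconj z"] by (simp add: p2 p2' z'_def xneg)
    also have "\<dots> = - (t j * xinner X a (z' \<odot> u) + t j' * xinner X (a \<odot> u) (z' \<odot> u \<odot> u))"
      by (simp add: uu xneg tt)
    also have "\<dots> = - (\<Lambda> * inner a (z' \<odot> u))"
      unfolding a_def ev(4) ..
    also have "\<dots> = \<Lambda> * inner (qconj p2 \<odot> q j) (qconj z \<odot> q j)"
      by (simp add: iu(1) p2 z'_def)
    finally show ?thesis
      by (simp add: inner_qmul_right nq inner_qconj)
  qed
  have bestI: "best X t q v" if "norm v = 1" "\<And>z. bpay X t q v z = \<Lambda> * inner v z" for v
    using best(1) that unfolding best_def by (simp add: \<Lambda>_def[symmetric] dot_square_norm)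
  have "inner (p i) p2 = inner (qconj (p i) \<odot> q j) (qconj p2 \<odot> q j)"
    by (simp add: inner_qmul_right nq inner_qconj)
  then have orth: "inner (p i) p2 = 0"
    by (simp add: p2 iu(2) flip: a_def)
  \<comment> \<open>\<open>v\<close> is the part of \<open>p i'\<close> orthogonal to
    \<open>p2\<close>. It is also orthogonal to \<open>p i\<close> and satisfies the eigenvector
    equation, so if nonzero it would give a third orthonormal best response.\<close>
  define c where "c = inner p2 (p i')"
  define v where "v = p i' - c *\<^sub>R p2"
  have "v = 0"
  proof (rule ccontr)
    assume v: "v \<noteq> 0"
    have "card (UNIV - {j, j'}) = 2"
      using t(2) by (simp add: card_Diff_subset)
    then obtain k k' where k: "UNIV - {j, j'} = {k, k'}" "k \<noteq> k'"
      by (meson card_2_iff)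
    have "k \<notin> {j, j'}" "k' \<notin> {j, j'}"
      using k(1) by blast+
    then have tk: "t k = 0" "t k' = 0"
      using t_out by blast+
    have "bpay X t q v z = \<Lambda> * inner v z" for z
      by (simp add: v_def bilinear_lsub[OF bilinear_bpay] bilinear_lmul[OF bilinear_bpay] eig eig2
          inner_diff_left algebra_simps)
    then have b3: "best X t q ((1 / norm v) *\<^sub>R v)"
      using v by (intro bestI) (simp_all add: bilinear_lmul[OF bilinear_bpay])
    have "inner (p i) ((1 / norm v) *\<^sub>R v) = 0" "inner p2 ((1 / norm v) *\<^sub>R v) = 0"
      using s(2) by (simp_all add: v_def inner_diff_right orthoframe_inner[OF p] orth c_def dot_square_norm n2)
    then show False
      using no_three_best[OF gen mix k(2) tk best(1) bestI[OF n2 eig2] b3 orth] by blast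
  qed
  then have pc: "p i' = c *\<^sub>R p2"
    by (simp add: v_def)
  then have "\<bar>c\<bar> = 1"
    using np[of i'] n2 by simp
  then have "c\<^sup>2 = 1"
    by (metis one_power2 power2_abs)
  moreover have "qconj (p i') = c *\<^sub>R qconj p2"
    unfolding pc by (rule linear_scale[OF linear_qconj])
  ultimately show ?thesis
    unfolding au by (intro exI[of _ c]) (simp add: qmul_bilinear_simps p2 p2' flip: a_def)
qed

section \<open>Symmetries of intertwined quadruples\<close>

lemma qK_minus [simp]: "qK (- x) = qK x"
  by (simp add: qK_def)

text \<open>Conjugation flips three of the four coordinates, so \<open>qK\<close> changes sign on
  both sides and the same constant works.\<close>

lemma intertwined_qconj:
  "intertwined (qconj a) (qconj b) (qconj a') (qconj b') \<longleftrightarrow> intertwined a b a' b'"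
proof -
  have "qK (x *\<^sub>R qconj a + y *\<^sub>R qconj b) = - qK (x *\<^sub>R a + y *\<^sub>R b)" for x y a b
    by (simp add: qK_def) algebra
  then show ?thesis
    by (simp add: intertwined_def)
qed

text \<open>For \<open>c = 1\<close> the two identities coincide; for \<open>c = - 1\<close> they
  differ by replacing \<open>y\<close> with \<open>- y\<close>, because \<open>qK\<close> is
  even.\<close>

lemma intertwined_transpose:
  assumes "c\<^sup>2 = 1" "b = c *\<^sub>R a'" "b' = - c *\<^sub>R a"
  shows "intertwined a b a' b' \<longleftrightarrow> intertwined a a' b b'"
proof -
  have neg: "qK (x *\<^sub>R a' - y *\<^sub>R a) = qK (y *\<^sub>R a - x *\<^sub>R a')" for x y
    using qK_minus[of "x *\<^sub>R a' - y *\<^sub>R a"] by simp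
  have "c = 1 \<or> c = - 1"
    using assms(1) by (simp add: power2_eq_1_iff)
  then show ?thesis
  proof
    assume "c = 1"
    then show ?thesis using assms by simp
  next
    assume c: "c = - 1"
    have "(\<forall>x y. \<alpha> * qK (x *\<^sub>R a - y *\<^sub>R a') = qK (x *\<^sub>R a' + y *\<^sub>R a)) \<longleftrightarrow>
          (\<forall>x y. \<alpha> * qK (x *\<^sub>R a + y *\<^sub>R a') = qK (y *\<^sub>R a - x *\<^sub>R a'))" for \<alpha>
    proof (intro iffI allI)
      fix x y assume "\<forall>x y. \<alpha> * qK (x *\<^sub>R a - y *\<^sub>R a') = qK (x *\<^sub>R a' + y *\<^sub>R a)"
      from this[rule_format, of x "- y"]
      show "\<alpha> * qK (x *\<^sub>R a + y *\<^sub>R a') = qK (y *\<^sub>R a - x *\<^sub>R a')"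
        by (simp add: neg)
    next
      fix x y assume "\<forall>x y. \<alpha> * qK (x *\<^sub>R a + y *\<^sub>R a') = qK (y *\<^sub>R a - x *\<^sub>R a')"
      from this[rule_format, of x "- y", folded neg]
      show "\<alpha> * qK (x *\<^sub>R a - y *\<^sub>R a') = qK (x *\<^sub>R a' + y *\<^sub>R a)"
        using qK_minus[of "x *\<^sub>R a' + y *\<^sub>R a"] by simp
    qed
    then show ?thesis
      using assms(2,3) c by (simp add: intertwined_def)
  qed
qed

text \<open>An unequal pair of weights gives one intertwining identity, an equal pair gives the
  symmetry \<open>b = c *\<^sub>R a'\<close>, \<open>b' = - c *\<^sub>R a\<close>. With one pair of
  each kind the symmetry transfers the identity to its transpose; two equal pairs give the second
  alternative.\<close>

lemma equilibrium_two:
  assumes eq: "equilibrium X Y s p t q"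
    and s: "{i. s i > 0} = {i, i'}" "i \<noteq> i'" and t: "{j. t j > 0} = {j, j'}" "j \<noteq> j'"
  defines "a \<equiv> qconj (p i) \<odot> q j" and "b \<equiv> qconj (p i') \<odot> q j"
    and "a' \<equiv> qconj (p i) \<odot> q j'" and "b' \<equiv> qconj (p i') \<odot> q j'"
  shows "fully_intertwined a b a' b' \<or>
    s i = s i' \<and> t j = t j' \<and> (\<exists>c. c\<^sup>2 = 1 \<and> b = c *\<^sub>R a')"
proof -
  note eq' = equilibrium_swap[OF eq]
  have conj: "qconj (q j) \<odot> p i = qconj a" "qconj (q j) \<odot> p i' = qconj b"
    "qconj (q j') \<odot> p i = qconj a'" "qconj (q j') \<odot> p i' = qconj b'"
    by (simp_all add: a_def b_def a'_def b'_def qconj_qmul)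
  have I: "intertwined a b a' b'" if "t j \<noteq> t j'"
    using equilibrium_two_unequal[OF eq s t that] by (simp add: a_def b_def a'_def b'_def)
  have II: "intertwined a a' b b'" if "s i \<noteq> s i'"
    using equilibrium_two_unequal[OF eq' t s that] by (simp add: conj intertwined_qconj)
  have R: "\<exists>c. c\<^sup>2 = 1 \<and> b = c *\<^sub>R a' \<and> b' = - c *\<^sub>R a" if "t j = t j' \<or> s i = s i'"
    using that
  proof
    assume "t j = t j'"
    from equilibrium_two_equal[OF eq s t this] show ?thesis
      by (simp add: a_def b_def a'_def b'_def)
  next
    assume "s i = s i'"
    from equilibrium_two_equal[OF eq' t s this] obtain c where
      c: "c\<^sup>2 = 1" "qconj a' = c *\<^sub>R qconj b" "qconj b' = - c *\<^sub>R qconj a"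
      unfolding conj by blast
    \<comment> \<open>Exchanging the players exchanges \<open>b\<close> and \<open>a'\<close>; the
      relation obtained is inverted by means of \<open>c\<^sup>2 = 1\<close>.\<close>
    have "a' = c *\<^sub>R b" "b' = - c *\<^sub>R a"
      using c(2,3) by (metis linear_scale[OF linear_qconj] qconj_qconj)+
    moreover have "b = c *\<^sub>R (c *\<^sub>R b)"
      using c(1) by (simp add: power2_eq_square)
    ultimately show ?thesis
      using c(1) by blast
  qed
  show ?thesis
  proof (cases "t j = t j' \<or> s i = s i'")
    case True
    from R[OF this] obtain c where c: "c\<^sup>2 = 1" "b = c *\<^sub>R a'" "b' = - c *\<^sub>R a"
      by blast
    show ?thesis
      using I II intertwined_transpose[OF c] c unfolding fully_intertwined_def by blast
  next
    case False
    then show ?thesis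
      using I II by (simp add: fully_intertwined_def)
  qed
qed


section \<open>Mixed strategies and their moments\<close>

lemma mixed_strategiesD:
  assumes "\<mu> \<in> mixed_strategies"
  shows "prob_space \<mu>" "sets \<mu> = sets unit_quat_borel" "space \<mu> = unit_quats"
  using assms sets_eq_imp_space_eq[of \<mu> unit_quat_borel]
  by (auto simp: mixed_strategies_def space_unit_quat_borel)

lemma integrable_mixed_strategy:
  fixes f :: "quaternion \<Rightarrow> real"
  assumes \<mu>: "\<mu> \<in> mixed_strategies" and f: "continuous_on UNIV f"
  shows "integrable \<mu> f"
proof -
  interpret prob_space \<mu>
    using \<mu> by (rule mixed_strategiesD)
  have "compact (f ` unit_quats)"
    by (intro compact_continuous_image continuous_on_subset[OF f] compact_sphere) simp
  then obtain K where K: "\<And>x. x \<in> unit_quats \<Longrightarrow> norm (f x) \<le> K"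
    by (meson bounded_iff compact_imp_bounded imageI)
  have "f \<in> borel_measurable unit_quat_borel"
    unfolding unit_quat_borel_def
    by (intro measurable_restrict_space1 borel_measurable_continuous_onI f)
  then have "f \<in> borel_measurable \<mu>"
    using mixed_strategiesD(2)[OF \<mu>] by (simp cong: measurable_cong_sets)
  then show ?thesis
    using K by (intro integrable_const_bound[of _ K]) (auto simp: mixed_strategiesD(3)[OF \<mu>])
qed

text \<open>The second moments form a nonnegative symmetric form, which is diagonal in some
  orthonormal frame. Its trace is the mean of the squared norm, which is one on the sphere.\<close>

lemma moment_mixture:
  assumes \<mu>: "\<mu> \<in> mixed_strategies"
  shows "\<exists>w b. mixture w b \<and> (\<forall>x. (\<integral>z. (inner z x)\<^sup>2 \<partial>\<mu>) = mform w b x)"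
proof -
  interpret prob_space \<mu>
    using \<mu> by (rule mixed_strategiesD)
  define B where "B = (\<lambda>x y. \<integral>z. inner z x * inner z y \<partial>\<mu>)"
  have int: "integrable \<mu> (\<lambda>z. inner z x * inner z y)" for x y
    by (intro integrable_mixed_strategy[OF \<mu>] continuous_intros)
  have sym: "B x y = B y x" for x y
    by (simp add: B_def mult.commute)
  have "linear (\<lambda>y. B x y)" for x
    by (rule linearI) (simp_all add: B_def inner_add_right distrib_left int mult.left_commute)
  then have bil: "bilinear B"
    unfolding bilinear_def by (simp add: sym[of _ y for y])
  from bilinear_diagonalization[OF bil sym subspace_UNIV] obtain E where
    E: "pairwise orthogonal E" "\<forall>x\<in>E. norm x = 1" "span E = UNIV"
      "\<forall>x\<in>E. \<forall>y\<in>E. x \<noteq> y \<longrightarrow> B x y = 0"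
    by blast
  obtain b where b: "orthoframe b" "range b = E"
    using orthoframe_extension[OF E(1) _ E(3)] E(2) by blast
  define w where "w = (\<lambda>i. B (b i) (b i))"
  have Bb: "B (b i) (b j) = (if i = j then w i else 0)" for i j
    using E(4) b inj_eq[OF orthoframe_inj[OF b(1)]] by (auto simp: w_def)
  have "B x x = mform w b x" for x
  proof -
    have lin: "linear (\<lambda>y. B z y)" "linear (\<lambda>y. B y z)" for z
      using bil by (simp_all add: bilinear_def)
    have expand: "B x z = (\<Sum>i\<in>UNIV. inner (b i) x * B (b i) z)" for x z
    proof -
      have "B x z = B (\<Sum>i\<in>UNIV. inner (b i) x *\<^sub>R b i) z"
        using orthoframe_expansion[OF b(1), of x] by simp
      then show ?thesis
        by (simp only: linear_sum[OF lin(2)] linear_scale[OF lin(2)] real_scaleR_def)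
    qed
    have "B (b i) x = inner (b i) x * w i" for i
      unfolding sym[of "b i" x] expand[of x] Bb
      by (simp add: if_distrib[of "\<lambda>y. _ * y"] cong: if_cong)
    then have "B x x = mform w b x"
      using expand[of x x] by (simp add: mform_def power2_eq_square mult_ac)
    then show ?thesis .
  qed
  moreover have "(\<Sum>i\<in>UNIV. w i) = 1"
  proof -
    have "(\<Sum>i\<in>UNIV. w i) = (\<integral>z. (\<Sum>i\<in>UNIV. inner z (b i) * inner z (b i)) \<partial>\<mu>)"
      by (simp add: w_def B_def int)
    also have "\<dots> = (\<integral>z. 1 \<partial>\<mu>)"
    proof (rule Bochner_Integration.integral_cong[OF refl])
      fix z assume "z \<in> space \<mu>"
      then show "(\<Sum>i\<in>UNIV. inner z (b i) * inner z (b i)) = 1"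
        using orthoframe_parseval[OF b(1), of z]
        by (simp add: mixed_strategiesD(3)[OF \<mu>] power2_eq_square inner_commute)
    qed
    finally show ?thesis
      by (simp add: prob_space)
  qed
  moreover have "0 \<le> w i" for i
    by (simp add: w_def B_def)
  ultimately show ?thesis
    using b(1) by (intro exI[of _ w] exI[of _ b]) (simp add: mixture_def B_def power2_eq_square)
qed

lemma qmul_nth_inner: "(p \<odot> q) $ t = inner q (qconj p \<odot> qunit t)"
  using qconj_qmul_nth[of "qconj p" q t] by simp

text \<open>Each outcome probability is a squared inner product of \<open>q\<close> with a vector
  depending only on \<open>p\<close> and \<open>t\<close>, so strategies enter the equivalence only
  through second moments.\<close>

lemma strategy_equivI:
  assumes "\<And>x. (\<integral>z. (inner z x)\<^sup>2 \<partial>\<mu>) = (\<integral>z. (inner z x)\<^sup>2 \<partial>\<mu>')"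
  shows "strategy_equiv \<mu> \<mu>'"
  using assms by (simp add: strategy_equiv_def qmul_nth_inner)

section \<open>Finitely supported strategies\<close>

definition discrete_strategy :: "(4 \<Rightarrow> real) \<Rightarrow> (4 \<Rightarrow> quaternion) \<Rightarrow> quaternion measure" where
  "discrete_strategy w b = distr (measure_pmf (embed_pmf w)) unit_quat_borel b"

lemma mixture_measurable:
  "mixture w b \<Longrightarrow> b \<in> measurable (measure_pmf p) unit_quat_borel"
  using orthoframe_norm[of b] by (auto simp: mixture_def space_unit_quat_borel)

lemma pmf_mixture:
  assumes "mixture w b"
  shows "pmf (embed_pmf w) j = w j"
proof (rule pmf_embed_pmf)
  show "0 \<le> w x" for x
    using assms by (simp add: mixture_def)
  have "(\<integral>\<^sup>+x. ennreal (w x) \<partial>count_space UNIV) = (\<Sum>x\<in>UNIV. ennreal (w x))"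
    by (simp add: nn_integral_count_space_finite)
  also have "\<dots> = ennreal (\<Sum>x\<in>UNIV. w x)"
    using assms by (intro sum_ennreal) (simp add: mixture_def)
  finally show "(\<integral>\<^sup>+x. ennreal (w x) \<partial>count_space UNIV) = 1"
    using assms by (simp add: mixture_def)
qed

lemma discrete_mixed:
  assumes "mixture w b"
  shows "discrete_strategy w b \<in> mixed_strategies"
  unfolding discrete_strategy_def mixed_strategies_def
  using measure_pmf.prob_space_distr[OF mixture_measurable[OF assms]] by simp

lemma integral_discrete:
  fixes f :: "quaternion \<Rightarrow> real"
  assumes mix: "mixture w b" and f: "f \<in> borel_measurable unit_quat_borel"
  shows "(\<integral>z. f z \<partial>discrete_strategy w b) = (\<Sum>j\<in>UNIV. w j * f (b j))"
proof -
  have "(\<integral>z. f z \<partial>discrete_strategy w b) = (\<integral>j. f (b j) \<partial>measure_pmf (embed_pmf w))"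
    unfolding discrete_strategy_def by (rule integral_distr[OF mixture_measurable[OF mix] f])
  also have "\<dots> = (\<Sum>j\<in>UNIV. f (b j) * pmf (embed_pmf w) j)"
    by (rule integral_measure_pmf_real) auto
  finally show ?thesis
    by (simp add: pmf_mixture[OF mix] mult.commute)
qed

lemma moment_discrete:
  assumes "mixture w b"
  shows "(\<integral>z. (inner z x)\<^sup>2 \<partial>discrete_strategy w b) = mform w b x"
  unfolding mform_def
  by (intro integral_discrete[OF assms])
    (auto simp: unit_quat_borel_def intro!: measurable_restrict_space1 borel_measurable_continuous_onI
      continuous_intros)

lemma measure_discrete:
  assumes mix: "mixture w b" and A: "A \<in> sets unit_quat_borel"
  shows "measure (discrete_strategy w b) A = (\<Sum>j\<in>{j. b j \<in> A}. w j)"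
proof -
  have "measure (discrete_strategy w b) A = (\<integral>z. indicator A z \<partial>discrete_strategy w b)"
    using A by (simp add: discrete_strategy_def)
  also have "\<dots> = (\<Sum>j\<in>UNIV. w j * indicator A (b j))"
    using A by (intro integral_discrete[OF mix] borel_measurable_indicator)
  also have "\<dots> = (\<Sum>j\<in>{j. b j \<in> A}. w j)"
    by (intro sum.mono_neutral_cong_right) auto
  finally show ?thesis .
qed

lemma singleton_unit_quat_borel: "x \<in> unit_quats \<Longrightarrow> {x} \<in> sets unit_quat_borel"
  by (auto simp: unit_quat_borel_def sets_restrict_space intro!: image_eqI[of _ _ "{x}"])

lemma measure_discrete_point:
  assumes mix: "mixture w b"
  shows "measure (discrete_strategy w b) {b k} = w k"
proof -
  have b: "orthoframe b"
    using mix by (simp add: mixture_def)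
  have "{j. b j \<in> {b k}} = {k}"
    using orthoframe_inj[OF b] by (auto dest: injD)
  then show ?thesis
    using orthoframe_norm[OF b, of k]
    by (simp add: measure_discrete[OF mix] singleton_unit_quat_borel)
qed

lemma msupport_discrete:
  assumes mix: "mixture w b"
  shows "msupport (discrete_strategy w b) = b ` {j. w j > 0}"
proof -
  have b: "orthoframe b" and w: "\<And>j. 0 \<le> w j"
    using mix by (auto simp: mixture_def)
  interpret prob_space "discrete_strategy w b"
    using discrete_mixed[OF mix] by (rule mixed_strategiesD)
  have sp: "space (discrete_strategy w b) = unit_quats" and st: "sets (discrete_strategy w b) = sets unit_quat_borel"
    using discrete_mixed[OF mix] by (auto dest: mixed_strategiesD)
  have op: "U \<inter> unit_quats \<in> sets unit_quat_borel" if "open U" for U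
    using that by (auto simp: unit_quat_borel_def sets_restrict_space)
  have m: "measure (discrete_strategy w b) (U \<inter> unit_quats) = (\<Sum>j\<in>{j. b j \<in> U}. w j)" if "open U" for U
    using orthoframe_norm[OF b] by (simp add: measure_discrete[OF mix op[OF that]])
  have pos: "emeasure (discrete_strategy w b) (U \<inter> unit_quats) > 0 \<longleftrightarrow> (\<exists>j. b j \<in> U \<and> w j > 0)" if "open U" for U
    unfolding emeasure_eq_measure m[OF that] using w
    by (auto simp: less_le sum_nonneg_eq_0_iff sum_nonneg)
  show ?thesis
  proof (intro equalityI subsetI)
    fix x assume x: "x \<in> msupport (discrete_strategy w b)"
    \<comment> \<open>The complement of these finitely many points is open and carries no mass, so
      it contains no point of the support.\<close>
    have "open (- (b ` {j. w j > 0}))"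
      by (intro open_Compl finite_imp_closed) simp
    from pos[OF this] x show "x \<in> b ` {j. w j > 0}"
      unfolding msupport_def sp using \<open>open (- (b ` {j. w j > 0}))\<close> by blast
  next
    fix x assume "x \<in> b ` {j. w j > 0}"
    then show "x \<in> msupport (discrete_strategy w b)"
      unfolding msupport_def sp using pos orthoframe_norm[OF b] by auto
  qed
qed

section \<open>Payoffs in terms of second moments\<close>

definition payoff_vector :: "(move \<Rightarrow> move \<Rightarrow> real) \<Rightarrow> quaternion" where
  "payoff_vector P = quat (P C C) (P D D) (P C D) (P D C)"

lemma quantum_payoff_wpay: "quantum_payoff P p q = wpay (payoff_vector P) (qconj p) q"
  by (simp add: quantum_payoff_def wpay_def payoff_vector_def sum_4 mult.commute)

lemma generic_payoff_vector:
  assumes "generic_payoffs P"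
  shows "generic (payoff_vector P)"
proof -
  have i: "inj (\<lambda>(a, b). P a b)" and j: "inj_on (\<lambda>S. \<Sum>(a, b)\<in>S. P a b) {S. card S = 2}"
    using assms by (auto simp: generic_payoffs_def)
  have P: "P a b \<noteq> P c d" if "(a, b) \<noteq> (c, d)" for a b c d
    using injD[OF i, of "(a, b)" "(c, d)"] that by auto
  have S: "P a b + P c d \<noteq> P e f + P g h"
    if "(a, b) \<noteq> (c, d)" "(e, f) \<noteq> (g, h)" "{(a, b), (c, d)} \<noteq> {(e, f), (g, h)}" for a b c d e f g h
    using inj_onD[OF j, of "{(a, b), (c, d)}" "{(e, f), (g, h)}"] that by auto
  have "inj (($) (payoff_vector P))"
  proof (rule injI)
    fix s t :: 4 assume "payoff_vector P $ s = payoff_vector P $ t"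
    then show "s = t"
      using exhaust_4[of s] exhaust_4[of t] P by (auto simp: payoff_vector_def)
  qed
  then show ?thesis
    \<comment> \<open>The three ways of splitting the four outcomes into two pairs.\<close>
    using S[of C C D D C D D C] S[of C C C D D D D C] S[of C C D C D D C D]
    by (simp add: generic_def payoff_vector_def doubleton_eq_iff)
qed

text \<open>The map \<open>f\<close> is conjugation when \<open>\<mu>\<close> is Player One's
  strategy and the identity when it is Player Two's.\<close>

lemma integral_wpay:
  assumes "\<mu> \<in> mixed_strategies" and f: "continuous_on UNIV f"
    and m: "\<And>x. (\<integral>z. (inner (f z) x)\<^sup>2 \<partial>\<mu>) = mform w b x"
  shows "(\<integral>z. wpay X (f z) y \<partial>\<mu>) = bpay X w b y y"
proof -
  have "(\<integral>z. wpay X (f z) y \<partial>\<mu>) = (\<integral>z. (\<Sum>t\<in>UNIV. X$t * (inner (f z) (y \<odot> qunit t))\<^sup>2) \<partial>\<mu>)"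
    by (subst wpay_commute) (simp only: wpay_def qconj_qmul_nth)
  also have "\<dots> = (\<Sum>t\<in>UNIV. X$t * (\<integral>z. (inner (f z) (y \<odot> qunit t))\<^sup>2 \<partial>\<mu>))"
    by (subst Bochner_Integration.integral_sum)
      (auto intro!: integrable_mixed_strategy[OF assms(1)] continuous_intros f)
  also have "\<dots> = bpay X w b y y"
    by (simp add: m bpay_mform sum_4)
  finally show ?thesis .
qed

lemma continuous_on_qconj: "continuous_on A qconj"
  using linear_qconj by (simp add: linear_continuous_on linear_conv_bounded_linear)

lemma mixed_payoff_mform:
  assumes \<nu>: "\<nu> \<in> mixed_strategies" and \<mu>: "\<mu> \<in> mixed_strategies"
    and n: "\<And>x. (\<integral>z. (inner (qconj z) x)\<^sup>2 \<partial>\<nu>) = mform s p x"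
    and m: "\<And>x. (\<integral>z. (inner z x)\<^sup>2 \<partial>\<mu>) = mform t q x"
  shows "mixed_payoff P \<nu> \<mu> = (\<Sum>i\<in>UNIV. s i * bpay (payoff_vector P) t q (p i) (p i))"
    and "mixed_payoff P \<nu> \<mu> = (\<Sum>j\<in>UNIV. t j * bpay (payoff_vector P) s p (q j) (q j))"
proof -
  let ?X = "payoff_vector P"
  have w: "continuous_on UNIV (\<lambda>z. wpay ?X z y)" for y
    unfolding wpay_commute[of ?X _ y]
    by (auto simp: wpay_def qconj_qmul_nth intro!: continuous_intros)
  have "mixed_payoff P \<nu> \<mu> = (\<integral>z. bpay ?X s p z z \<partial>\<mu>)"
    unfolding mixed_payoff_def quantum_payoff_wpay
    by (simp only: integral_wpay[OF \<nu> continuous_on_qconj n])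
  also have "\<dots> = (\<Sum>i\<in>UNIV. s i * (\<integral>z. wpay ?X z (p i) \<partial>\<mu>))"
    unfolding bpay_wpay
    by (subst Bochner_Integration.integral_sum) (auto intro!: integrable_mixed_strategy[OF \<mu>] continuous_intros w)
  also have "\<dots> = (\<Sum>i\<in>UNIV. s i * bpay ?X t q (p i) (p i))"
    by (simp only: integral_wpay[OF \<mu> continuous_on_id m])
  finally show 1: "mixed_payoff P \<nu> \<mu> = (\<Sum>i\<in>UNIV. s i * bpay ?X t q (p i) (p i))" .
  have "(\<Sum>i\<in>UNIV. s i * bpay ?X t q (p i) (p i)) = (\<Sum>i\<in>UNIV. \<Sum>j\<in>UNIV. t j * (s i * wpay ?X (q j) (p i)))"
    by (simp add: bpay_wpay sum_distrib_left mult.left_commute wpay_commute)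
  also have "\<dots> = (\<Sum>j\<in>UNIV. t j * bpay ?X s p (q j) (q j))"
    by (subst sum.swap) (simp add: bpay_wpay sum_distrib_left)
  finally show "mixed_payoff P \<nu> \<mu> = (\<Sum>j\<in>UNIV. t j * bpay ?X s p (q j) (q j))"
    using 1 by simp
qed


section \<open>The classification\<close>

lemma nash_equilibrium:
  assumes gen: "generic_game P1 P2" and nash: "quantum_nash P1 P2 \<nu> \<mu>"
    and s: "mixture s p" and t: "mixture t q"
    and n: "\<And>x. (\<integral>z. (inner (qconj z) x)\<^sup>2 \<partial>\<nu>) = mform s p x"
    and m: "\<And>x. (\<integral>z. (inner z x)\<^sup>2 \<partial>\<mu>) = mform t q x"
  shows "equilibrium (payoff_vector P1) (payoff_vector P2) s p t q"
proof -
  have \<nu>: "\<nu> \<in> mixed_strategies" and \<mu>: "\<mu> \<in> mixed_strategies"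
    and nash1: "\<And>\<nu>'. \<nu>' \<in> mixed_strategies \<Longrightarrow> mixed_payoff P1 \<nu>' \<mu> \<le> mixed_payoff P1 \<nu> \<mu>"
    and nash2: "\<And>\<mu>'. \<mu>' \<in> mixed_strategies \<Longrightarrow> mixed_payoff P2 \<nu> \<mu>' \<le> mixed_payoff P2 \<nu> \<mu>"
    using nash by (auto simp: quantum_nash_def)
  \<comment> \<open>No term exceeds the weighted mean, so every term of positive weight equals
    it.\<close>
  have best: "best X w b (c i)"
    if mix: "mixture v c" and i: "v i > 0"
      and le: "\<And>x. norm x = 1 \<Longrightarrow> bpay X w b x x \<le> (\<Sum>i\<in>UNIV. v i * bpay X w b (c i) (c i))"
    for X w b v c and i :: 4
  proof -
    define V where "V = (\<Sum>i\<in>UNIV. v i * bpay X w b (c i) (c i))"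
    have v: "(\<Sum>i\<in>UNIV. v i) = 1" "\<And>i. 0 \<le> v i" and c: "orthoframe c"
      using mix by (auto simp: mixture_def)
    have nn: "0 \<le> v i * (V - bpay X w b (c i) (c i))" for i
      using v(2)[of i] le[OF orthoframe_norm[OF c, of i]] by (simp add: V_def)
    have "(\<Sum>i\<in>UNIV. v i * (V - bpay X w b (c i) (c i))) = (\<Sum>i\<in>UNIV. v i) * V - V"
      by (simp add: right_diff_distrib sum_subtractf V_def sum_distrib_right)
    then have "(\<Sum>i\<in>UNIV. v i * (V - bpay X w b (c i) (c i))) = 0"
      using v(1) by simp
    then have "v i * (V - bpay X w b (c i) (c i)) = 0"
      using nn by (simp add: sum_nonneg_eq_0_iff)
    then have "bpay X w b (c i) (c i) = V"
      using i by simp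
    then show ?thesis
      using le orthoframe_norm[OF c] by (simp add: best_def V_def)
  qed
  \<comment> \<open>A pure deviation \<open>x\<close> is presented as a mixture: all weight lies on
    \<open>x \<odot> qunit 1 = x\<close>, and the other three frame vectors are padding.\<close>
  define \<delta> :: "4 \<Rightarrow> real" where "\<delta> = (\<lambda>t. if t = 1 then 1 else 0)"
  have pure: "mixture \<delta> (\<lambda>t. x \<odot> qunit t)" if "norm x = 1" for x
    using orthoframe_qmul_left[OF that orthoframe_qunit] by (simp add: mixture_def \<delta>_def)
  have pure_sum: "(\<Sum>t\<in>UNIV. \<delta> t * f t) = f 1" for f :: "4 \<Rightarrow> real"
    by (simp add: \<delta>_def if_distrib[of "\<lambda>x. x * _"] cong: if_cong)
  have b1: "bpay (payoff_vector P1) t q x x \<le> (\<Sum>i\<in>UNIV. s i * bpay (payoff_vector P1) t q (p i) (p i))"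
    if x: "norm x = 1" for x
  proof -
    define \<nu>' where "\<nu>' = discrete_strategy \<delta> (\<lambda>t. qconj (x \<odot> qunit t))"
    have mix': "mixture \<delta> (\<lambda>t. qconj (x \<odot> qunit t))"
      using pure[OF x] by (simp add: mixture_def orthoframe_def inner_qconj)
    have \<nu>': "\<nu>' \<in> mixed_strategies"
      unfolding \<nu>'_def by (rule discrete_mixed[OF mix'])
    have "(\<integral>z. (inner (qconj z) y)\<^sup>2 \<partial>\<nu>') = mform \<delta> (\<lambda>t. x \<odot> qunit t) y" for y
    proof -
      have "(\<integral>z. (inner (qconj z) y)\<^sup>2 \<partial>\<nu>') = (\<integral>z. (inner z (qconj y))\<^sup>2 \<partial>\<nu>')"
        using inner_qconj[of _ "qconj y"] by simp
      also have "\<dots> = mform \<delta> (\<lambda>t. x \<odot> qunit t) y"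
        unfolding \<nu>'_def moment_discrete[OF mix'] by (simp add: mform_def inner_qconj)
      finally show ?thesis .
    qed
    from mixed_payoff_mform(1)[OF \<nu>' \<mu> this m, of P1]
    have "mixed_payoff P1 \<nu>' \<mu> = bpay (payoff_vector P1) t q x x"
      by (simp add: pure_sum)
    then show ?thesis
      using nash1[OF \<nu>'] unfolding mixed_payoff_mform(1)[OF \<nu> \<mu> n m] by simp
  qed
  have b2: "bpay (payoff_vector P2) s p x x \<le> (\<Sum>j\<in>UNIV. t j * bpay (payoff_vector P2) s p (q j) (q j))"
    if x: "norm x = 1" for x
  proof -
    define \<mu>' where "\<mu>' = discrete_strategy \<delta> (\<lambda>t. x \<odot> qunit t)"
    have \<mu>': "\<mu>' \<in> mixed_strategies"
      unfolding \<mu>'_def by (rule discrete_mixed[OF pure[OF x]])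
    have "mixed_payoff P2 \<nu> \<mu>' = bpay (payoff_vector P2) s p x x"
      using mixed_payoff_mform(2)[OF \<nu> \<mu>' n, of \<delta> "\<lambda>t. x \<odot> qunit t" P2]
      by (simp add: \<mu>'_def moment_discrete[OF pure[OF x]] pure_sum)
    then show ?thesis
      using nash2[OF \<mu>'] unfolding mixed_payoff_mform(2)[OF \<nu> \<mu> n m] by simp
  qed
  show ?thesis
    using gen s t best[OF s _ b1] best[OF t _ b2]
    by (auto simp: equilibrium_def generic_game_def generic_payoff_vector)
qed

section \<open>Translation to a normal form\<close>

lemma qinv_unit: "norm u = 1 \<Longrightarrow> qinv u = qconj u"
  by (simp add: qinv_def)

lemma qconj_qmul_cancel: "norm r = 1 \<Longrightarrow> qconj r \<odot> (r \<odot> x) = x" "norm r = 1 \<Longrightarrow> r \<odot> (qconj r \<odot> x) = x"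
  by (simp_all add: qconj_qmul_self flip: qmul_assoc)

lemma inner_qconj_qmul:
  assumes "norm r = 1"
  shows "inner (qconj r \<odot> z) x = inner z (r \<odot> x)"
proof -
  have "inner (qconj r \<odot> z) x = inner (r \<odot> (qconj r \<odot> z)) (r \<odot> x)"
    unfolding inner_qmul_left[of r] using assms by simp
  then show ?thesis
    by (simp add: qconj_qmul_cancel assms)
qed

text \<open>The translating quaternion is \<open>qconj r\<close>: Player One's strategy is
  multiplied by \<open>r\<close> on the right and Player Two's by \<open>qconj r\<close> on the
  left. In the conjugated convention both are left translations by \<open>qconj r\<close>.\<close>

lemma pair_equiv_discrete:
  assumes \<nu>0: "\<nu>0 \<in> mixed_strategies" and \<mu>0: "\<mu>0 \<in> mixed_strategies"
    and n0: "\<And>x. (\<integral>z. (inner (qconj z) x)\<^sup>2 \<partial>\<nu>0) = mform s0 p0 x"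
    and m0: "\<And>x. (\<integral>z. (inner z x)\<^sup>2 \<partial>\<mu>0) = mform t0 q0 x"
    and s: "mixture s p" and t: "mixture t q" and r: "norm r = 1"
    and n: "\<And>x. mform s p x = mform s0 p0 (r \<odot> qconj x)"
    and m: "\<And>x. mform t q x = mform t0 q0 (r \<odot> x)"
  shows "pair_equiv (\<nu>0, \<mu>0) (discrete_strategy s p, discrete_strategy t q)"
proof -
  have meas: "f \<in> borel_measurable unit_quat_borel" if "continuous_on UNIV f" for f :: "quaternion \<Rightarrow> real"
    using that unfolding unit_quat_borel_def
    by (intro measurable_restrict_space1 borel_measurable_continuous_onI)
  have "(\<integral>z. (inner z x)\<^sup>2 \<partial>discrete_strategy s p) = (\<integral>z. (inner z x)\<^sup>2 \<partial>right_translate \<nu>0 (qconj r))" for x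
  proof -
    have mb: "(\<lambda>z. z \<odot> r) \<in> measurable \<nu>0 unit_quat_borel"
      unfolding measurable_cong_sets[OF mixed_strategiesD(2)[OF \<nu>0] refl]
      using r by (intro measurable_unit_quat_borel continuous_on_qmul_right) (simp add: norm_qmul)
    have "inner (z \<odot> r) x = inner (qconj z) (r \<odot> qconj x)" for z
      using inner_qconj_qmul[OF r, of "qconj z" "qconj x"] inner_qconj[of "z \<odot> r" x] by (simp add: qconj_qmul)
    then have "(\<integral>z. (inner z x)\<^sup>2 \<partial>right_translate \<nu>0 (qconj r)) = mform s0 p0 (r \<odot> qconj x)"
      unfolding right_translate_def using r mb
      by (subst integral_distr) (auto simp: qinv_unit n0 intro!: meas continuous_intros)
    then show ?thesis
      by (simp add: moment_discrete[OF s] n)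
  qed
  moreover have "(\<integral>z. (inner z x)\<^sup>2 \<partial>discrete_strategy t q) = (\<integral>z. (inner z x)\<^sup>2 \<partial>left_translate (qinv (qconj r)) \<mu>0)" for x
  proof -
    have mb: "(\<lambda>z. qconj r \<odot> z) \<in> measurable \<mu>0 unit_quat_borel"
      unfolding measurable_cong_sets[OF mixed_strategiesD(2)[OF \<mu>0] refl]
      using r by (intro measurable_unit_quat_borel continuous_on_qmul_left) (simp add: norm_qmul)
    then have "(\<integral>z. (inner z x)\<^sup>2 \<partial>left_translate (qinv (qconj r)) \<mu>0) = mform t0 q0 (r \<odot> x)"
      unfolding left_translate_def using r mb
      by (subst integral_distr) (auto simp: qinv_unit inner_qconj_qmul m0 intro!: meas continuous_intros)
    then show ?thesis
      by (simp add: moment_discrete[OF t] m)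
  qed
  ultimately show ?thesis
    unfolding pair_equiv_def using r
    by (auto intro!: bexI[of _ "qconj r"] strategy_equivI)
qed

lemma mform_qconj: "mform w b (qconj x) = mform w (\<lambda>t. qconj (b t)) x"
  using inner_qconj[of _ "qconj x"] by (simp add: mform_def)

lemma mform_qmul: "norm r = 1 \<Longrightarrow> mform w b (r \<odot> x) = mform w (\<lambda>t. qconj r \<odot> b t) x"
  by (simp add: mform_def inner_qconj_qmul)

text \<open>Conjugation only changes signs in the standard frame, so undoing the convention for
  Player One does not affect moments that are diagonal there.\<close>

lemma mform_qunit_qconj: "mform w qunit (qconj x) = mform w qunit x"
  by (simp add: mform_def sum_4 inner_quaternion)

lemma dim_orthonormal_pair:
  fixes x y :: "'a::euclidean_space"
  assumes "norm x = 1" "norm y = 1" "inner x y = 0"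
  shows "dim (span {x, y}) = 2"
proof -
  have "x \<noteq> y" "0 \<notin> {x, y}"
    using assms by (auto simp: dot_square_norm)
  then have "independent {x, y}"
    using assms(3) by (intro pairwise_orthogonal_independent)
      (auto simp: pairwise_def orthogonal_def inner_commute)
  then have "dim {x, y} = card {x, y}"
    by (rule dim_eq_card_independent)
  then show ?thesis
    using \<open>x \<noteq> y\<close> by simp
qed

theorem theorem3p3:
  fixes P1 P2 :: "move \<Rightarrow> move \<Rightarrow> real" and \<nu>0 \<mu>0 :: "quaternion measure"
  assumes "generic_game P1 P2"
    and "quantum_nash P1 P2 \<nu>0 \<mu>0"
  shows "\<exists>\<nu> \<in> mixed_strategies. \<exists>\<mu> \<in> mixed_strategies. pair_equiv (\<nu>0, \<mu>0) (\<nu>, \<mu>) \<and>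
    ((\<forall>\<rho> \<in> {\<nu>, \<mu>}. \<exists>S \<subseteq> unit_quats. card S = 4 \<and> pairwise orthogonal S \<and>
         (\<forall>x \<in> S. measure \<rho> {x} = 1/4))
   \<or> (\<forall>\<rho> \<in> {\<nu>, \<mu>}. card (msupport \<rho>) = 3 \<and> msupport \<rho> \<subseteq> {q1, qi, qj, qk})
   \<or> (\<exists>u \<in> unit_quats. \<exists>v \<in> unit_quats. \<exists>p \<in> unit_quats.
         orthogonal q1 u \<and> msupport \<mu> = {q1, u} \<and>
         orthogonal p (p \<odot> v) \<and> msupport \<nu> = {p, p \<odot> v} \<and>
         fully_intertwined p (p \<odot> v) (p \<odot> u) (p \<odot> v \<odot> u))
   \<or> ((\<forall>\<rho> \<in> {\<nu>, \<mu>}. \<exists>x \<in> unit_quats. \<exists>y \<in> unit_quats.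
         orthogonal x y \<and> msupport \<rho> = {x, y} \<and> measure \<rho> {x} = 1/2 \<and> measure \<rho> {y} = 1/2) \<and>
      in_parallel_planes \<mu> \<nu>)
   \<or> (\<forall>\<rho> \<in> {\<nu>, \<mu>}. \<exists>x \<in> {q1, qi, qj, qk}. msupport \<rho> = {x}))"
    (is "\<exists>\<nu> \<in> _. \<exists>\<mu> \<in> _. pair_equiv _ _ \<and> (?A \<nu> \<mu> \<or> ?B \<nu> \<mu> \<or> ?C \<nu> \<mu> \<or> ?D \<nu> \<mu> \<or> ?E \<nu> \<mu>)")
proof -
  have \<nu>0: "\<nu>0 \<in> mixed_strategies" and \<mu>0: "\<mu>0 \<in> mixed_strategies"
    using assms(2) by (auto simp: quantum_nash_def)
  obtain s p' where s: "mixture s p'" "\<And>x. (\<integral>z. (inner z x)\<^sup>2 \<partial>\<nu>0) = mform s p' x"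
    using moment_mixture[OF \<nu>0] by blast
  obtain t q where t: "mixture t q" "\<And>x. (\<integral>z. (inner z x)\<^sup>2 \<partial>\<mu>0) = mform t q x"
    using moment_mixture[OF \<mu>0] by blast
  define p where "p = (\<lambda>i. qconj (p' i))"
  have sp: "mixture s p"
    using s(1) by (simp add: mixture_def orthoframe_def p_def inner_qconj)
  have n0: "(\<integral>z. (inner (qconj z) x)\<^sup>2 \<partial>\<nu>0) = mform s p x" for x
  proof -
    have "(\<integral>z. (inner (qconj z) x)\<^sup>2 \<partial>\<nu>0) = (\<integral>z. (inner z (qconj x))\<^sup>2 \<partial>\<nu>0)"
      using inner_qconj[of _ "qconj x"] by simp
    then show ?thesis
      by (simp add: s(2) mform_qconj p_def)
  qed
  have eq: "equilibrium (payoff_vector P1) (payoff_vector P2) s p t q"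
    by (rule nash_equilibrium[OF assms sp t(1) n0 t(2)])
  note equivI = pair_equiv_discrete[OF \<nu>0 \<mu>0 n0 t(2)]
  have goal: ?thesis
    if "mixture s' p''" "mixture t' q''" "norm r = 1"
      "\<And>x. mform s' p'' x = mform s p (r \<odot> qconj x)" "\<And>x. mform t' q'' x = mform t q (r \<odot> x)"
      "?A (discrete_strategy s' p'') (discrete_strategy t' q'') \<or> ?B (discrete_strategy s' p'') (discrete_strategy t' q'')
       \<or> ?C (discrete_strategy s' p'') (discrete_strategy t' q'') \<or> ?D (discrete_strategy s' p'') (discrete_strategy t' q'')
       \<or> ?E (discrete_strategy s' p'') (discrete_strategy t' q'')" for s' p'' t' q'' r
    using equivI[OF that(1-5)] that(6) discrete_mixed[OF that(1)] discrete_mixed[OF that(2)] by blast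
  have q1: "norm q1 = 1"
    using orthoframe_norm[OF orthoframe_qunit, of 1] by simp
  from equilibrium_classification[OF eq] show ?thesis
  proof (elim disjE exE conjE)
    assume n: "\<forall>x. mform s p x = (norm x)\<^sup>2 / 4" and m: "\<forall>x. mform t q x = (norm x)\<^sup>2 / 4"
    \<comment> \<open>Uniform weights give the same moments in every orthonormal frame; the standard
      frame is chosen, and the translation is trivial.\<close>
    define w :: "4 \<Rightarrow> real" where "w = (\<lambda>t. 1/4)"
    have w: "mixture w qunit"
      by (simp add: mixture_def orthoframe_qunit w_def)
    have mw: "mform w qunit x = (norm x)\<^sup>2 / 4" for x
      by (rule mform_uniform[OF orthoframe_qunit]) (simp add: w_def)
    have "card (range qunit) = 4"
      using orthoframe_inj[OF orthoframe_qunit] by (simp add: card_image)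
    moreover have "range qunit \<subseteq> unit_quats"
      using orthoframe_norm[OF orthoframe_qunit] by auto
    moreover have "pairwise orthogonal (range qunit)"
      using orthoframe_inner[OF orthoframe_qunit] by (auto simp: pairwise_def orthogonal_def)
    moreover have "\<forall>x\<in>range qunit. measure (discrete_strategy w qunit) {x} = 1/4"
      using measure_discrete_point[OF w] by (auto simp: w_def)
    ultimately have "?A (discrete_strategy w qunit) (discrete_strategy w qunit)"
      by blast
    then show ?thesis
      by (intro goal[OF w w q1]) (simp_all add: n m mw)
  next
    fix r \<alpha> \<beta>
    assume r: "norm r = 1" and \<alpha>: "mixture \<alpha> (\<lambda>t. r \<odot> qunit t)" and \<beta>: "mixture \<beta> (\<lambda>t. r \<odot> qunit t)"
      and card: "card {k. \<alpha> k > 0} = 3" "card {k. \<beta> k > 0} = 3"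
      and n: "\<forall>x. mform s p x = mform \<alpha> (\<lambda>t. r \<odot> qunit t) x"
      and m: "\<forall>x. mform t q x = mform \<beta> (\<lambda>t. r \<odot> qunit t) x"
    have \<alpha>': "mixture \<alpha> qunit" and \<beta>': "mixture \<beta> qunit"
      using \<alpha> \<beta> by (simp_all add: mixture_def orthoframe_qunit)
    have supp: "card (msupport (discrete_strategy w qunit)) = 3 \<and> msupport (discrete_strategy w qunit) \<subseteq> {q1, qi, qj, qk}"
      if "mixture w qunit" "card {k. w k > 0} = 3" for w
      using that(2) card_image[OF inj_on_subset[OF orthoframe_inj[OF orthoframe_qunit] subset_UNIV]]
      unfolding msupport_discrete[OF that(1)] range_qunit[symmetric] by auto
    have "?B (discrete_strategy \<alpha> qunit) (discrete_strategy \<beta> qunit)"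
      using supp[OF \<alpha>' card(1)] supp[OF \<beta>' card(2)] by blast
    then show ?thesis
      by (intro goal[OF \<alpha>' \<beta>' r]) (simp_all add: n m mform_qmul r qconj_qmul_cancel mform_qunit_qconj)
  next
    fix r k l
    assume r: "norm r = 1" and n: "\<forall>x. mform s p x = (inner (r \<odot> qunit k) x)\<^sup>2"
      and m: "\<forall>x. mform t q x = (inner (r \<odot> qunit l) x)\<^sup>2"
    define \<delta> :: "4 \<Rightarrow> 4 \<Rightarrow> real" where "\<delta> = (\<lambda>k t. if t = k then 1 else 0)"
    have \<delta>: "mixture (\<delta> k) qunit" for k
      by (simp add: mixture_def orthoframe_qunit \<delta>_def)
    have m\<delta>: "mform (\<delta> k) qunit x = (inner (qunit k) x)\<^sup>2" for k x
      by (rule mform_single) (simp_all add: \<delta>_def)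
    have "msupport (discrete_strategy (\<delta> k) qunit) = {qunit k}" for k
      unfolding msupport_discrete[OF \<delta>] by (auto simp: \<delta>_def)
    then have "?E (discrete_strategy (\<delta> k) qunit) (discrete_strategy (\<delta> l) qunit)"
      unfolding range_qunit[symmetric] by blast
    moreover have "mform (\<delta> k) qunit x = (inner (r \<odot> qunit k) (r \<odot> qconj x))\<^sup>2" for x
      using m\<delta>[of k "qconj x"] by (simp add: mform_qunit_qconj m\<delta> inner_qmul_left r)
    ultimately show ?thesis
      by (intro goal[OF \<delta>[of k] \<delta>[of l] r]) (simp_all add: n m m\<delta> inner_qmul_left r)
  next
    assume card: "card {i. s i > 0} = 2" "card {j. t j > 0} = 2"
    obtain i i' where i: "{i. s i > 0} = {i, i'}" "i \<noteq> i'"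
      using card(1) by (meson card_2_iff)
    obtain j j' where j: "{j. t j > 0} = {j, j'}" "j \<noteq> j'"
      using card(2) by (meson card_2_iff)
    have p: "orthoframe p" and q: "orthoframe q"
      using sp t(1) by (auto simp: mixture_def)
    \<comment> \<open>Left translation by \<open>qconj (q j)\<close> moves \<open>q j\<close> to
      \<open>1\<close>. Here \<open>c\<close> is the translated frame of Player Two, and
      \<open>a\<close> is that of Player One with the conjugation undone.\<close>
    define a where "a = (\<lambda>i. qconj (p i) \<odot> q j)"
    define c where "c = (\<lambda>k. qconj (q j) \<odot> q k)"
    define u where "u = c j'"
    define v where "v = qconj (a i) \<odot> a i'"
    note nq = orthoframe_norm[OF q] and np = orthoframe_norm[OF p]
    have oa: "orthoframe a" and oc: "orthoframe c"
      using p q np nq by (simp_all add: orthoframe_def a_def c_def inner_qmul_left inner_qmul_right inner_qconj)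
    then have sa: "mixture s a" and tc: "mixture t c"
      using sp t(1) by (simp_all add: mixture_def)
    have na: "norm (a i) = 1" for i
      by (rule orthoframe_norm[OF oa])
    have nu: "norm u = 1" and nv: "norm v = 1"
      by (simp_all add: u_def c_def v_def norm_qmul nq na)
    have cj: "c j = q1"
      by (simp add: c_def qconj_qmul_self nq)
    have av: "a i \<odot> v = a i'"
      by (simp add: v_def qconj_qmul_cancel na)
    have au: "a k \<odot> u = qconj (p k) \<odot> q j'" for k
      by (simp add: a_def u_def c_def qmul_assoc qconj_qmul_cancel nq)
    have supp: "msupport (discrete_strategy s a) = {a i, a i'}" "msupport (discrete_strategy t c) = {q1, u}"
      unfolding msupport_discrete[OF sa] msupport_discrete[OF tc] i(1) j(1) by (simp_all add: cj u_def)
    have orth: "inner (a i) (a i') = 0" "inner q1 u = 0"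
      using orthoframe_inner[OF oa, of i i'] orthoframe_inner[OF oc, of j j'] i(2) j(2)
      by (simp_all add: cj u_def)
    have "?C (discrete_strategy s a) (discrete_strategy t c) \<or> ?D (discrete_strategy s a) (discrete_strategy t c)"
      using equilibrium_two[OF eq i j]
    proof
      assume "fully_intertwined (qconj (p i) \<odot> q j) (qconj (p i') \<odot> q j) (qconj (p i) \<odot> q j') (qconj (p i') \<odot> q j')"
      then have "fully_intertwined (a i) (a i \<odot> v) (a i \<odot> u) (a i \<odot> v \<odot> u)"
        unfolding av au by (simp add: a_def)
      then have "?C (discrete_strategy s a) (discrete_strategy t c)"
        using nu nv na supp orth
        by (intro bexI[of _ u] bexI[of _ v] bexI[of _ "a i"]) (simp_all add: av orthogonal_def)
      then show ?thesis ..
    next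
      assume half: "s i = s i' \<and> t j = t j' \<and>
        (\<exists>c. c\<^sup>2 = 1 \<and> qconj (p i') \<odot> q j = c *\<^sub>R (qconj (p i) \<odot> q j'))"
      then obtain e where "e\<^sup>2 = 1" "qconj (p i') \<odot> q j = e *\<^sub>R (qconj (p i) \<odot> q j')"
        by blast
      moreover have "a i' = qconj (p i') \<odot> q j"
        by (simp add: a_def)
      ultimately have e: "e\<^sup>2 = 1" "a i' = e *\<^sub>R (a i \<odot> u)"
        by (simp_all only: au)
      have half_weights: "w k = 1/2 \<and> w k' = 1/2"
        if "mixture w b" "{k. w k > 0} = {k, k'}" "k \<noteq> k'" "w k = w k'" for w b and k k' :: 4
      proof -
        have "(\<Sum>k\<in>UNIV. w k) = (\<Sum>k\<in>{k, k'}. w k)"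
          using that(1,2) by (intro sum.mono_neutral_right) (auto simp: mixture_def less_le)
        then show ?thesis
          using that by (simp add: mixture_def)
      qed
      have w: "measure (discrete_strategy s a) {a i} = 1/2" "measure (discrete_strategy s a) {a i'} = 1/2"
        "measure (discrete_strategy t c) {q1} = 1/2" "measure (discrete_strategy t c) {u} = 1/2"
        using half half_weights[OF sa i] half_weights[OF tc j]
          measure_discrete_point[OF sa] measure_discrete_point[OF tc, of j] measure_discrete_point[OF tc, of j']
        by (simp_all add: cj u_def)
      have lin: "linear (\<lambda>w. a i \<odot> w)"
        using bilinear_qmul by (simp add: bilinear_def)
      \<comment> \<open>Since \<open>a i'\<close> is \<open>a i \<odot> u\<close> up to sign, Player
        One's plane is the image of the plane of \<open>1\<close> and \<open>u\<close> under left
        multiplication by \<open>a i\<close>.\<close>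
      have "span {a i, a i'} = span {a i, a i \<odot> u}"
      proof (intro equalityI span_minimal subspace_span)
        show "{a i, a i'} \<subseteq> span {a i, a i \<odot> u}"
          unfolding e(2) by (auto intro: span_base span_scale)
        have "a i \<odot> u = e *\<^sub>R a i'"
          using e by (simp add: power2_eq_square)
        then show "{a i, a i \<odot> u} \<subseteq> span {a i, a i'}"
          by (auto intro: span_base span_scale)
      qed
      also have "\<dots> = (\<lambda>w. a i \<odot> w) ` span {q1, u}"
        using real_vector.linear_span_image[OF lin, of "{q1, u}"] by simp
      finally have "in_parallel_planes (discrete_strategy t c) (discrete_strategy s a)"
        unfolding in_parallel_planes_def supp
        using dim_orthonormal_pair[OF na na orth(1)] dim_orthonormal_pair[OF q1 nu orth(2)] na
        by (intro conjI bexI[of _ "a i"]) simp_all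
      moreover have "\<exists>x\<in>unit_quats. \<exists>y\<in>unit_quats. orthogonal x y \<and> msupport (discrete_strategy s a) = {x, y} \<and>
          measure (discrete_strategy s a) {x} = 1/2 \<and> measure (discrete_strategy s a) {y} = 1/2"
        using na orth supp w by (intro bexI[of _ "a i"] bexI[of _ "a i'"]) (simp_all add: orthogonal_def)
      moreover have "\<exists>x\<in>unit_quats. \<exists>y\<in>unit_quats. orthogonal x y \<and> msupport (discrete_strategy t c) = {x, y} \<and>
          measure (discrete_strategy t c) {x} = 1/2 \<and> measure (discrete_strategy t c) {y} = 1/2"
        using nu q1 orth supp w by (intro bexI[of _ q1] bexI[of _ u]) (simp_all add: orthogonal_def)
      ultimately show ?thesis
        by blast
    qed
    moreover have "mform s a x = mform s p (q j \<odot> qconj x)" "mform t c x = mform t q (q j \<odot> x)" for x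
      unfolding mform_qmul[OF nq] mform_qconj by (simp_all add: a_def c_def qconj_qmul)
    ultimately show ?thesis
      by (intro goal[OF sa tc nq[of j]]) blast+
  qed
qed

end
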